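(* For any $k \in \mathbb{R}$, all the non-trivial zeros of the function $s\mapsto W_1(k;s)$ lie on the critical line $\operatorname{Re}(s) = -\frac{1}{2}$.
   Context: For real $k$ and complex $s$, $$W_1(k;s) = \frac{1}{2 \pi i} \int_{|x|=1} \left|k + x + x^{-1} \right|^s \frac{dx}{x},$$ defined by this integral where it converges and extended to a meromorphic function of $s\in\mathbb{C}$ by analytic continuation. *)

theory Defs
  imports "HOL-Complex_Analysis.Complex_Analysis"
begin

definition W1_integrand :: "real \<Rightarrow> complex \<Rightarrow> complex \<Rightarrow> complex" where
  "W1_integrand k s x =
     complex_of_real (cmod (complex_of_real k + x + inverse x)) powr s / x"

(* Convergence is absolute (Lebesgue) convergence of the parametrised contour integral.
   For |k| \<le> 2 the integrand is singular at the zeros of k + x + 1/x on the unit circle. *)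
definition W1_converges :: "real \<Rightarrow> complex \<Rightarrow> bool" where
  "W1_converges k s \<longleftrightarrow>
     (\<lambda>t. W1_integrand k s (circlepath 0 1 t) * vector_derivative (circlepath 0 1) (at t))
       absolutely_integrable_on {0..1}"

definition W1_integral :: "real \<Rightarrow> complex \<Rightarrow> complex" where
  "W1_integral k s =
     1 / (2 * complex_of_real pi * \<i>) * contour_integral (circlepath 0 1) (W1_integrand k s)"

(* "Nicely" meromorphic fixes the values at the isolated singularities: removable
   singularities are removed and poles get the dummy value 0. The region of convergence
   contains the half-plane Re s > 0, so at most one such function exists. *)
definition W1 :: "real \<Rightarrow> complex \<Rightarrow> complex" where
  "W1 k = (THE W. W nicely_meromorphic_on UNIV \<and>
                  (\<forall>s. W1_converges k s \<longrightarrow> W s = W1_integral k s))"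

(* Poles are excluded explicitly because of the dummy value 0. *)
definition W1_zeros :: "real \<Rightarrow> complex set" where
  "W1_zeros k = {s. \<not> is_pole (W1 k) s \<and> W1 k s = 0}"

(* The trivial zeros are the ones forced by the functional equation relating s and -1 - s,
   and come from its gamma factors:
     |k| < 2: W1 k s = Gamma (s + 1) / Gamma (s/2 + 1)^2 * 2F1 (-s/2, -s/2; 1/2; k^2/4),
              and by Euler's transformation the 2F1 factor is, up to the nonvanishing
              factor (1 - k^2/4) powr (s + 1/2), invariant under s \<mapsto> -1 - s;
              the gamma factor vanishes exactly at -2, -4, -6, ...
     |k| = 2: W1 k s = Gamma (2*s + 1) / Gamma (s + 1)^2, vanishing exactly
              at -1, -2, -3, ...
     |k| > 2: W1 k s / (k^2 - 4) powr (s/2) is entire and invariant under s \<mapsto> -1 - s,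
              so there are no trivial zeros. *)
definition W1_trivial_zeros :: "real \<Rightarrow> complex set" where
  "W1_trivial_zeros k =
     (if \<bar>k\<bar> < 2 then {- of_nat (2 * n) | n. n \<ge> 1}
      else if \<bar>k\<bar> = 2 then {- of_nat n | n. n \<ge> 1}
      else {})"

definition W1_nontrivial_zeros :: "real \<Rightarrow> complex set" where
  "W1_nontrivial_zeros k = W1_zeros k - W1_trivial_zeros k"

end

theory Submission
  imports Defs
begin

text \<open>
  Up to a power of a constant, \<open>W1 k s\<close> is the mean of \<open>\<bar>S x + C x cos t\<bar> ^ s\<close> over a half period, where
  \<open>\<bar>k\<bar> = 2 tanh x\<close> and \<open>(S, C) = (sinh, cosh)\<close> if \<open>\<bar>k\<bar> < 2\<close>, and \<open>\<bar>k\<bar> = 2 coth x\<close> and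
  \<open>(S, C) = (cosh, sinh)\<close> if \<open>\<bar>k\<bar> > 2\<close>. As a function of \<open>x\<close> this mean solves the Sturm--Liouville
  equation \<open>(C p')' = s (s + 1) C p\<close>. If \<open>p x = 0\<close>, then \<open>s (s + 1)\<close> is an eigenvalue of a self-adjoint
  boundary value problem on \<open>[0, x]\<close> and hence real and nonpositive, so that either \<open>Re s = -1/2\<close> or
  \<open>s\<close> lies in the real interval \<open>[-1, 0]\<close>, where positivity of the integrand excludes zeros.

  For \<open>\<bar>k\<bar> < 2\<close> the integral converges only for \<open>Re s > -1\<close>. There it is a quotient of gamma factors
  times the solution of the differential equation with \<open>p 0 = 1\<close> and \<open>p' 0 = 0\<close>. The Picard series of
  this solution is entire in \<open>s (s + 1)\<close>, which yields the meromorphic continuation and its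
  invariance under \<open>s \<mapsto> -1 - s\<close> at once. Finally, \<open>W1 2 s = W1 0 (2 s)\<close> is a pure gamma quotient.
\<close>

section \<open>Sturm--Liouville equations\<close>

text \<open>
  Integrating the derivative of \<open>w p' cnj p\<close> over \<open>[0, R]\<close> gives
  \<open>0 = lam * (\<integral> w \<bar>p\<bar>\<^sup>2) + (\<integral> w \<bar>p'\<bar>\<^sup>2)\<close>.
\<close>

lemma sturm_liouville_eigenvalue_nonpos:
  fixes p p' :: "real \<Rightarrow> complex" and w :: "real \<Rightarrow> real" and lam :: complex
  assumes "R > 0"
    and p: "\<And>x. x \<in> {0..R} \<Longrightarrow> (p has_vector_derivative p' x) (at x within {0..R})"
    and q: "\<And>x. x \<in> {0..R} \<Longrightarrow>
      ((\<lambda>x. of_real (w x) * p' x) has_vector_derivative lam * of_real (w x) * p x) (at x within {0..R})"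
    and w_cont: "continuous_on {0..R} w" and p'_cont: "continuous_on {0..R} p'"
    and w_pos: "\<And>x. x \<in> {0<..R} \<Longrightarrow> w x > 0"
    and bdry: "w 0 = 0 \<or> p' 0 = 0" "p R = 0" and nz: "p 0 \<noteq> 0"
  shows "Im lam = 0 \<and> Re lam \<le> 0"
proof -
  define q where "q = (\<lambda>x. of_real (w x) * p' x)"
  have p_cont: "continuous_on {0..R} p"
    by (rule continuous_on_vector_derivative) (rule p)
  define a where "a = (\<lambda>x. w x * (norm (p x))\<^sup>2)"
  define b where "b = (\<lambda>x. w x * (norm (p' x))\<^sup>2)"
  have a_cont: "continuous_on {0..R} a" and b_cont: "continuous_on {0..R} b"
    unfolding a_def b_def by (intro continuous_intros w_cont p_cont p'_cont)+
  have w0: "w x \<ge> 0" if "x \<in> {0..R}" for x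
  proof -
    have "continuous_on (closure {0<..R}) w" "x \<in> closure {0<..R}"
      using w_cont \<open>R > 0\<close> that by simp_all
    thus ?thesis
      by (rule continuous_ge_on_closure) (use w_pos in force)
  qed
  have "((\<lambda>x. q x * cnj (p x)) has_vector_derivative
           q x * cnj (p' x) + lam * of_real (w x) * p x * cnj (p x)) (at x within {0..R})"
    if "x \<in> {0..R}" for x
    unfolding q_def by (intro has_vector_derivative_mult
      bounded_linear.has_vector_derivative[OF bounded_linear_cnj] p q that)
  moreover have "q x * cnj (p' x) + lam * of_real (w x) * p x * cnj (p x) =
       of_real (b x) + lam * of_real (a x)" for x
    by (simp only: q_def a_def b_def of_real_mult complex_norm_square mult_ac)
  ultimately have "((\<lambda>x. of_real (b x) + lam * of_real (a x)) has_integral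
       (q R * cnj (p R) - q 0 * cnj (p 0))) {0..R}"
    using \<open>R > 0\<close> by (intro fundamental_theorem_of_calculus) auto
  \<comment> \<open>The boundary term at \<open>R\<close> vanishes by \<open>p R = 0\<close>; the
    one at 0 vanishes through the weight (as for \<open>sinh\<close>) or through \<open>p'\<close>
    (as for \<open>cosh\<close>).\<close>
  hence 1: "((\<lambda>x. of_real (b x) + lam * of_real (a x)) has_integral 0) {0..R}"
    using bdry by (auto simp: q_def)
  define A where "A = integral {0..R} a"
  define B where "B = integral {0..R} b"
  have A: "(a has_integral A) {0..R}" and B: "(b has_integral B) {0..R}"
    unfolding A_def B_def
    by (intro integrable_integral integrable_continuous_interval a_cont b_cont)+
  have "((\<lambda>x. of_real (b x) + lam * of_real (a x)) has_integral of_real B + lam * of_real A) {0..R}"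
    by (intro has_integral_add has_integral_mult_right has_integral_of_real A B)
  with 1 have eq: "of_real B + lam * of_real A = 0"
    by (rule has_integral_unique[symmetric])
  have a0: "a x \<ge> 0" and b0: "b x \<ge> 0" if "x \<in> {0..R}" for x
    using w0[OF that] by (auto simp: a_def b_def)
  have "B \<ge> 0" by (rule has_integral_nonneg[OF B]) (use b0 in auto)
  have "A \<ge> 0" by (rule has_integral_nonneg[OF A]) (use a0 in auto)
  \<comment> \<open>As the weight may vanish at 0, \<open>A = 0\<close> first gives
    \<open>p = 0\<close> only off 0; continuity carries this to 0, against
    \<open>nz\<close>.\<close>
  have "A \<noteq> 0"
  proof
    assume "A = 0"
    have a_eq_0: "a x = 0" if "x \<in> {0..R}" for x
      using has_integral_0_cbox_imp_0[of 0 R a x] a_cont a0 A \<open>A = 0\<close> that \<open>R > 0\<close> by simp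
    have p0: "p x = 0" if "x \<in> {0<..R}" for x
      using a_eq_0[of x] that w_pos[of x] by (auto simp: a_def)
    have "p 0 = 0"
    proof (rule continuous_constant_on_closure[of "{0<..R}" p 0])
      show "continuous_on (closure {0<..R}) p" using p_cont \<open>R > 0\<close> by simp
      show "0 \<in> closure {0<..R}" using \<open>R > 0\<close> by simp
    qed (use p0 in auto)
    with nz show False by simp
  qed
  with \<open>A \<ge> 0\<close> have "A > 0" by simp
  have "Im lam * A = 0" "B + Re lam * A = 0"
    using arg_cong[OF eq, of Im] arg_cong[OF eq, of Re] by simp_all
  moreover from this have "Re lam * A \<le> 0" using \<open>B \<ge> 0\<close> by linarith
  ultimately show ?thesis using \<open>A > 0\<close> by (auto simp: mult_le_0_iff)
qed

text \<open>
  The functions \<open>\<psi>\<close>, \<open>\<psi>'\<close>, \<open>\<psi>''\<close> play the roles of \<open>y\<close> to the powers \<open>s\<close>, \<open>s - 1\<close>, \<open>s - 2\<close>, with the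
  appropriate signs if \<open>y\<close> may be negative. Since \<open>(v')\<^sup>2 = v\<^sup>2 + \<epsilon> sin\<^sup>2 t\<close>, differentiating twice
  under the integral produces a term with \<open>sin\<^sup>2 t\<close>, which integration by parts of
  \<open>sin t * \<psi>' (v x t)\<close> in \<open>t\<close> turns into one with \<open>cos t\<close>.
\<close>

lemma mean_power_ode:
  fixes S C :: "real \<Rightarrow> real" and \<psi> \<psi>' \<psi>'' :: "real \<Rightarrow> complex" and s :: complex
  defines "v \<equiv> \<lambda>x t. S x + C x * cos t"
  defines "v' \<equiv> \<lambda>x t. C x + S x * cos t"
  assumes U: "convex U" "x \<in> U"
    and S: "\<And>x. (S has_real_derivative C x) (at x)"
    and C: "\<And>x. (C has_real_derivative S x) (at x)"
    and SC: "\<And>x. (C x)\<^sup>2 - (S x)\<^sup>2 = \<epsilon>"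
    and D: "\<And>x t. x \<in> U \<Longrightarrow> t \<in> {0..pi} \<Longrightarrow> v x t \<in> D"
    and \<psi>: "\<And>y. y \<in> D \<Longrightarrow> (\<psi> has_vector_derivative s * \<psi>' y) (at y)"
    and \<psi>': "\<And>y. y \<in> D \<Longrightarrow> (\<psi>' has_vector_derivative (s - 1) * \<psi>'' y) (at y)"
    and \<psi>'': "continuous_on D \<psi>''"
    and mult: "\<And>y. y \<in> D \<Longrightarrow> of_real y * \<psi>'' y = \<psi>' y" "\<And>y. y \<in> D \<Longrightarrow> of_real y * \<psi>' y = \<psi> y"
  defines "g \<equiv> \<lambda>x. integral {0..pi} (\<lambda>t. \<psi> (v x t))"
  defines "g' \<equiv> \<lambda>x. s * integral {0..pi} (\<lambda>t. of_real (v' x t) * \<psi>' (v x t))"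
  shows "(g has_vector_derivative g' x) (at x within U)"
    and "((\<lambda>x. of_real (C x) * g' x) has_vector_derivative s * (s + 1) * of_real (C x) * g x)
           (at x within U)"
    and "continuous_on U g'"
proof -
  have S_cont: "continuous_on A S" and C_cont: "continuous_on A C" for A
    by (rule DERIV_continuous_on, rule has_field_derivative_at_within, rule S C)+
  have S_cont': "continuous_on A (\<lambda>z. S (f z))" and C_cont': "continuous_on A (\<lambda>z. C (f z))"
    if "continuous_on A f" for A and f :: "'a::topological_space \<Rightarrow> real"
    using continuous_on_compose2[OF S_cont that] continuous_on_compose2[OF C_cont that] by auto
  have \<psi>_cont: "continuous_on D \<psi>" and \<psi>'_cont: "continuous_on D \<psi>'"
    by (rule continuous_on_vector_derivative, rule has_vector_derivative_at_within, rule \<psi> \<psi>', assumption)+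
  have cont: "continuous_on (U \<times> {0..pi}) (\<lambda>z. \<psi> (v (fst z) (snd z)))"
    "continuous_on (U \<times> {0..pi}) (\<lambda>z. \<psi>' (v (fst z) (snd z)))"
    "continuous_on (U \<times> {0..pi}) (\<lambda>z. \<psi>'' (v (fst z) (snd z)))"
    by (rule continuous_on_compose2[OF \<psi>_cont] continuous_on_compose2[OF \<psi>'_cont]
             continuous_on_compose2[OF \<psi>''];
        (use D in \<open>auto simp: v_def intro!: continuous_intros S_cont' C_cont'\<close>))+
  have cont_t: "continuous_on {0..pi} (\<lambda>t. \<psi> (v y t))" "continuous_on {0..pi} (\<lambda>t. \<psi>' (v y t))"
    "continuous_on {0..pi} (\<lambda>t. \<psi>'' (v y t))" if "y \<in> U" for y
    by (rule continuous_on_compose2[OF \<psi>_cont] continuous_on_compose2[OF \<psi>'_cont]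
             continuous_on_compose2[OF \<psi>''];
        (use D that in \<open>auto simp: v_def intro!: continuous_intros\<close>))+
  have v_x: "((\<lambda>x. v x t) has_real_derivative v' x t) (at x)"
    and v'_x: "((\<lambda>x. v' x t) has_real_derivative v x t) (at x)" 
    and v_t: "((\<lambda>t. v x t) has_real_derivative - (C x * sin t)) (at t)" for x t
    unfolding v_def v'_def by (auto intro!: derivative_eq_intros S C)
  have \<psi>_x: "((\<lambda>x. \<psi> (v x t)) has_vector_derivative s * (of_real (v' x t) * \<psi>' (v x t))) (at x within U)"
    and \<psi>'_x: "((\<lambda>x. \<psi>' (v x t)) has_vector_derivative (s - 1) * (of_real (v' x t) * \<psi>'' (v x t))) (at x within U)"
    if "x \<in> U" "t \<in> {0..pi}" for x t
  proof -
    note chain = vector_diff_chain_within[of "\<lambda>x. v x t" "v' x t" x U,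
        OF _ has_vector_derivative_at_within, unfolded o_def]
    have v: "((\<lambda>x. v x t) has_vector_derivative v' x t) (at x within U)"
      using v_x[of t x]
      by (simp add: has_real_derivative_iff_has_vector_derivative has_vector_derivative_at_within)
    show "((\<lambda>x. \<psi> (v x t)) has_vector_derivative s * (of_real (v' x t) * \<psi>' (v x t))) (at x within U)"
      using chain[OF v \<psi>[OF D[OF that]]] by (simp add: scaleR_conv_of_real mult_ac)
    show "((\<lambda>x. \<psi>' (v x t)) has_vector_derivative (s - 1) * (of_real (v' x t) * \<psi>'' (v x t))) (at x within U)"
      using chain[OF v \<psi>'[OF D[OF that]]] by (simp add: scaleR_conv_of_real mult_ac)
  qed
  have g': "g' x = integral {0..pi} (\<lambda>t. s * (of_real (v' x t) * \<psi>' (v x t)))" for x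
    by (simp add: g'_def)
  \<comment> \<open>\<open>F\<close> is the integrand of the flux \<open>C x * g' x\<close>, and
    \<open>F'\<close> is its derivative in \<open>x\<close>.\<close>
  define F where "F = (\<lambda>x t. of_real (C x) * (s * (of_real (v' x t) * \<psi>' (v x t))))"
  define F' where "F' = (\<lambda>x t. s * (of_real (S x * v' x t) * \<psi>' (v x t) +
     of_real (C x) * (of_real (v x t) * \<psi>' (v x t) + (s - 1) * of_real ((v' x t)\<^sup>2) * \<psi>'' (v x t))))"
  have F: "((\<lambda>x. F x t) has_vector_derivative F' x t) (at x within U)"
    if "x \<in> U" "t \<in> {0..pi}" for x t
  proof -
    note C' = has_vector_derivative_of_real[OF has_field_derivative_at_within[OF C[of x], of U]]
    note v'' = has_vector_derivative_of_real[OF has_field_derivative_at_within[OF v'_x[of t x], of U]]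
    note deriv = has_vector_derivative_mult[OF C'
      has_vector_derivative_mult[OF has_vector_derivative_const[of s]
        has_vector_derivative_mult[OF v'' \<psi>'_x[OF that]]]]
    show ?thesis
      unfolding F_def F'_def
      by (rule has_vector_derivative_eq_rhs[OF deriv]) (simp add: algebra_simps power2_eq_square)
  qed
  have F_int: "integral {0..pi} (F x) = of_real (C x) * g' x" for x
    unfolding F_def g' by simp
  have cont1: "continuous_on (U \<times> {0..pi}) (\<lambda>z. of_real (v' (fst z) (snd z)) * \<psi>' (v (fst z) (snd z)))"
    unfolding v'_def by (intro continuous_intros cont(2) S_cont' C_cont')
  have cont2: "continuous_on (U \<times> {0..pi}) (\<lambda>z. F' (fst z) (snd z))"
    unfolding F'_def using cont
    by (auto simp: v'_def intro!: continuous_intros S_cont' C_cont')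
       (auto simp: v_def intro!: continuous_intros S_cont' C_cont')
  have F_cont: "continuous_on {0..pi} (F y)" if "y \<in> U" for y
    unfolding F_def v'_def by (intro continuous_intros cont_t that)
  have F'_cont: "continuous_on {0..pi} (F' y)" if "y \<in> U" for y
    unfolding F'_def v'_def
    by (intro continuous_intros cont_t that, unfold v_def, intro continuous_intros)
  show "(g has_vector_derivative g' x) (at x within U)"
    unfolding g_def g' using cont1 U cont_t
    by (intro leibniz_rule_vector_derivative[where a = 0 and b = pi, simplified])
       (auto simp: case_prod_unfold intro!: \<psi>_x continuous_intros integrable_continuous_interval)
  show "continuous_on U g'"
    unfolding g' using cont1
    by (intro integral_continuous_on_param[where a = 0 and b = pi, simplified])
       (auto simp: case_prod_unfold intro!: continuous_intros)
  have q: "((\<lambda>x. of_real (C x) * g' x) has_vector_derivative integral {0..pi} (F' x)) (at x within U)"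
    unfolding F_int[symmetric] using cont2 U F_cont
    by (intro leibniz_rule_vector_derivative[where a = 0 and b = pi, simplified])
       (auto simp: case_prod_unfold intro!: F integrable_continuous_interval)
  \<comment> \<open>The quantity for the integration by parts: its derivative \<open>E'\<close> has
    integral 0 because \<open>sin\<close> vanishes at 0 and \<open>pi\<close>.\<close>
  define E where "E = (\<lambda>t. of_real (sin t) * \<psi>' (v x t))"
  define E' where "E' = (\<lambda>t. of_real (cos t) * \<psi>' (v x t)
     - (s - 1) * of_real (C x * (sin t)\<^sup>2) * \<psi>'' (v x t))"
  have "(E has_vector_derivative E' t) (at t within {0..pi})" if "t \<in> {0..pi}" for t
  proof -
    have "((\<psi>' \<circ> v x) has_vector_derivative (- (C x * sin t)) *\<^sub>R ((s - 1) * \<psi>'' (v x t))) (at t within {0..pi})"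
      using v_t[of x t] \<psi>'[OF D[OF \<open>x \<in> U\<close> that]]
      by (intro vector_diff_chain_within)
         (auto simp: has_real_derivative_iff_has_vector_derivative intro: has_vector_derivative_at_within)
    hence *: "((\<lambda>t. \<psi>' (v x t)) has_vector_derivative of_real (- (C x * sin t)) * ((s - 1) * \<psi>'' (v x t))) (at t within {0..pi})"
      by (simp add: o_def scaleR_conv_of_real)
    have **: "(sin has_real_derivative cos t) (at t within {0..pi})"
      by (intro DERIV_sin has_field_derivative_at_within)
    show ?thesis
      unfolding E_def E'_def
      by (rule has_vector_derivative_eq_rhs[OF has_vector_derivative_mult[OF has_vector_derivative_of_real[OF **] *]])
         (simp add: algebra_simps power2_eq_square)
  qed
  hence E: "(E' has_integral (E pi - E 0)) {0..pi}"
    by (intro fundamental_theorem_of_calculus) auto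
  have E0: "E pi - E 0 = 0" by (simp add: E_def)
  have v'2: "(v' x t)\<^sup>2 = (v x t)\<^sup>2 + \<epsilon> * (sin t)\<^sup>2" for t
    unfolding v_def v'_def SC[of x, symmetric] sin_squared_eq by (simp add: power2_eq_square algebra_simps)
  have Sv': "S x * v' x t = C x * v x t - \<epsilon> * cos t" for t
    unfolding v_def v'_def SC[of x, symmetric] by (simp add: power2_eq_square algebra_simps)
  \<comment> \<open>After \<open>Sv'\<close> and \<open>v'2\<close>, the relations
    \<open>mult\<close> absorb the factors \<open>v x t\<close>. The terms without
    \<open>\<epsilon>\<close> add up to the right-hand side of the equation, and the others form a
    multiple of \<open>E'\<close>.\<close>
  have eq: "F' x t = s * (s + 1) * of_real (C x) * \<psi> (v x t) - s * of_real \<epsilon> * E' t"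
    if t: "t \<in> {0..pi}" for t
  proof -
    note m = mult(2)[OF D[OF \<open>x \<in> U\<close> t], symmetric] mult(1)[OF D[OF \<open>x \<in> U\<close> t], symmetric]
    show ?thesis
      unfolding F'_def E'_def Sv' v'2 m(1) unfolding m(2)
      by (simp add: algebra_simps power2_eq_square)
  qed
  have "(\<lambda>t. \<psi> (v x t)) integrable_on {0..pi}"
    by (intro integrable_continuous_interval cont_t U)
  hence "((\<lambda>t. \<psi> (v x t)) has_integral g x) {0..pi}"
    unfolding g_def by (rule integrable_integral)
  hence "((\<lambda>t. s * (s + 1) * of_real (C x) * \<psi> (v x t) - s * of_real \<epsilon> * E' t) has_integral
            s * (s + 1) * of_real (C x) * g x - s * of_real \<epsilon> * 0) {0..pi}"
    using E unfolding E0 by (intro has_integral_diff has_integral_mult_right)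
  hence "(F' x has_integral s * (s + 1) * of_real (C x) * g x) {0..pi}"
    by (subst has_integral_cong[OF eq]) simp_all
  with q show "((\<lambda>x. of_real (C x) * g' x) has_vector_derivative s * (s + 1) * of_real (C x) * g x)
           (at x within U)" by (simp add: integral_unique)
qed

section \<open>The Picard series\<close>

text \<open>The M-test makes the differentiated series converge uniformly, which justifies
  differentiation term by term, also at the endpoints of an interval.\<close>

lemma has_vector_derivative_series:
  fixes f :: "nat \<Rightarrow> real \<Rightarrow> 'a :: banach"
  assumes S: "convex S" "x \<in> S"
    and f: "\<And>n x. x \<in> S \<Longrightarrow> (f n has_vector_derivative f' n x) (at x within S)"
    and bd: "\<And>n x. x \<in> S \<Longrightarrow> norm (f' n x) \<le> M n" "summable M"
    and sums: "\<And>x. x \<in> S \<Longrightarrow> summable (\<lambda>n. f n x)"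
  shows "((\<lambda>x. \<Sum>n. f n x) has_vector_derivative (\<Sum>n. f' n x)) (at x within S)"
proof -
  have lim: "uniform_limit S (\<lambda>n x. \<Sum>i<n. f' i x) (\<lambda>x. \<Sum>i. f' i x) sequentially"
    by (rule Weierstrass_m_test) (use bd in auto)
  have "\<exists>g. \<forall>x\<in>S. (\<lambda>n. f n x) sums g x \<and> (g has_derivative (\<lambda>h. h *\<^sub>R (\<Sum>i. f' i x))) (at x within S)"
  proof (rule has_derivative_series[OF S(1)])
    show "(f n has_derivative (\<lambda>h. h *\<^sub>R f' n x)) (at x within S)" if "x \<in> S" for n x
      using f[OF that] by (simp add: has_vector_derivative_def)
    show "\<forall>\<^sub>F n in sequentially. \<forall>x\<in>S. \<forall>h.
        norm ((\<Sum>i<n. h *\<^sub>R f' i x) - h *\<^sub>R (\<Sum>i. f' i x)) \<le> e * norm h" if "e > 0" for e :: real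
      using uniform_limitD[OF lim that]
    proof eventually_elim
      case (elim n)
      show ?case
      proof (intro ballI allI)
        fix x and h :: real assume "x \<in> S"
        hence "norm ((\<Sum>i<n. f' i x) - (\<Sum>i. f' i x)) \<le> e"
          using elim by (auto simp: dist_norm intro: less_imp_le)
        hence "norm h * norm ((\<Sum>i<n. f' i x) - (\<Sum>i. f' i x)) \<le> norm h * e"
          by (intro mult_left_mono) auto
        thus "norm ((\<Sum>i<n. h *\<^sub>R f' i x) - h *\<^sub>R (\<Sum>i. f' i x)) \<le> e * norm h"
          by (simp add: scaleR_sum_right[symmetric] scaleR_diff_right[symmetric] mult_ac)
      qed
    qed
    show "x \<in> S" by fact
    show "(\<lambda>n. f n x) sums (\<Sum>n. f n x)" using sums[OF S(2)] by (rule summable_sums)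
  qed
  then obtain g where g: "\<And>x. x \<in> S \<Longrightarrow> (\<lambda>n. f n x) sums g x"
    "\<And>x. x \<in> S \<Longrightarrow> (g has_vector_derivative (\<Sum>i. f' i x)) (at x within S)"
    by (auto simp: has_vector_derivative_def)
  have "g x = (\<Sum>n. f n x)" if "x \<in> S" for x
    using g(1)[OF that] by (simp add: sums_iff)
  with g(2)[OF S(2)] show ?thesis
    using has_vector_derivative_transform[of x S "\<lambda>x. \<Sum>n. f n x" g] S(2) by simp
qed

text \<open>Coefficients of the power series in \<open>lam\<close> of the solution of
  \<open>(cosh y')' = lam cosh y\<close> with value 1 and slope 0 at the origin: two integrations
  per step invert the differential operator.\<close>

primrec picard :: "nat \<Rightarrow> real \<Rightarrow> real" where
  "picard 0 = (\<lambda>x. 1)"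
| "picard (Suc n) = (\<lambda>x. integral {0..x} (\<lambda>a. integral {0..a} (\<lambda>b. cosh b * picard n b) / cosh a))"

text \<open>For \<open>x >= 0\<close> this is \<open>cosh x\<close> times the derivative of
  \<open>picard (Suc n)\<close> at \<open>x\<close>, the halfway stage of a Picard step.\<close>

definition picard_flux :: "nat \<Rightarrow> real \<Rightarrow> real" where
  "picard_flux n x = integral {0..x} (\<lambda>b. cosh b * picard n b)"

lemma picard_Suc: "picard (Suc n) x = integral {0..x} (\<lambda>a. picard_flux n a / cosh a)"
  by (simp add: picard_flux_def)

lemma cosh_real_mono: "0 \<le> x \<Longrightarrow> x \<le> y \<Longrightarrow> cosh x \<le> cosh (y::real)"
  using cosh_real_nonneg_le_iff[of x y] by simp

lemma has_integral_monomial: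
  assumes "0 \<le> (x::real)"
  shows "((\<lambda>t. c * t ^ n / fact n) has_integral c * x ^ Suc n / fact (Suc n)) {0..x}"
proof -
  have "((\<lambda>t. c * t ^ n / fact n) has_integral c * x ^ Suc n / fact (Suc n) - c * 0 ^ Suc n / fact (Suc n)) {0..x}"
  proof (rule fundamental_theorem_of_calculus[OF assms])
    fix t assume "t \<in> {0..x}"
    have "((\<lambda>t. t ^ Suc n) has_real_derivative real (Suc n) * t ^ n) (at t within {0..x})"
      by (rule DERIV_pow[of "Suc n", simplified diff_Suc_1'])
    from DERIV_cmult[OF this, of "c / fact (Suc n)"]
    have "((\<lambda>t. c * t ^ Suc n / fact (Suc n)) has_real_derivative c * t ^ n / fact n) (at t within {0..x})"
      by (simp del: of_nat_Suc power_Suc)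
    thus "((\<lambda>t. c * t ^ Suc n / fact (Suc n)) has_vector_derivative c * t ^ n / fact n) (at t within {0..x})"
      by (simp add: has_real_derivative_iff_has_vector_derivative)
  qed
  thus ?thesis by simp
qed

text \<open>In the inner integral \<open>cosh b <= cosh a\<close>, and this bound cancels the
  division by \<open>cosh a\<close>. So each step is dominated by two plain integrations of a
  monomial.\<close>

lemma picard_continuous_bounds:
  "continuous_on {0..R} (picard n)"
  "0 \<le> x \<Longrightarrow> 0 \<le> picard n x \<and> picard n x \<le> x ^ (2*n) / fact (2*n)"
  "0 \<le> x \<Longrightarrow> 0 \<le> picard_flux n x \<and> picard_flux n x \<le> cosh x * x ^ Suc (2*n) / fact (Suc (2*n))"
  "continuous_on {0..R} (picard_flux n)"
proof -
  have flux_cont: "continuous_on {0..R} (picard_flux n)" if "\<And>R. continuous_on {0..R} (picard n)" for n R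
    unfolding picard_flux_def using that
    by (intro continuous_on_vector_derivative[OF integral_has_vector_derivative] continuous_intros) auto
  have flux: "0 \<le> picard_flux n x \<and> picard_flux n x \<le> cosh x * x ^ Suc (2*n) / fact (Suc (2*n))"
    if c: "\<And>R. continuous_on {0..R} (picard n)" and x: "0 \<le> x"
      and b: "\<And>x. 0 \<le> x \<Longrightarrow> 0 \<le> picard n x \<and> picard n x \<le> x ^ (2*n) / fact (2*n)" for n x
  proof -
    have int: "(\<lambda>b. cosh b * picard n b) integrable_on {0..x}"
      by (intro integrable_continuous_interval continuous_intros c)
    have "0 \<le> picard_flux n x"
      unfolding picard_flux_def by (intro integral_nonneg int) (use b in auto)
    moreover have "picard_flux n x \<le> cosh x * x ^ Suc (2*n) / fact (Suc (2*n))"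
      unfolding picard_flux_def
    proof (rule has_integral_le[OF integrable_integral[OF int] has_integral_monomial[OF x]])
      fix t assume t: "t \<in> {0..x}"
      have "cosh t * picard n t \<le> cosh x * (t ^ (2*n) / fact (2*n))"
        using b[of t] t by (intro mult_mono cosh_real_mono) auto
      thus "cosh t * picard n t \<le> cosh x * t ^ (2 * n) / fact (2 * n)" by simp
    qed
    ultimately show ?thesis by blast
  qed
  have main: "(\<forall>R. continuous_on {0..R} (picard n)) \<and>
     (\<forall>x\<ge>0. 0 \<le> picard n x \<and> picard n x \<le> x ^ (2*n) / fact (2*n))" for n
  proof (induction n)
    case 0
    show ?case by (auto simp: continuous_on_const)
  next
    case (Suc n)
    hence c: "\<And>R. continuous_on {0..R} (picard n)"
      and b: "\<And>x. 0 \<le> x \<Longrightarrow> 0 \<le> picard n x \<and> picard n x \<le> x ^ (2*n) / fact (2*n)" by auto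
    have qc: "continuous_on {0..R} (\<lambda>a. picard_flux n a / cosh a)" for R
      by (intro continuous_intros flux_cont c) auto
    have "continuous_on {0..R} (picard (Suc n))" for R
      unfolding picard_Suc[abs_def] using qc
      by (intro continuous_on_vector_derivative[OF integral_has_vector_derivative]) auto
    moreover have "0 \<le> picard (Suc n) x \<and> picard (Suc n) x \<le> x ^ (2*Suc n) / fact (2*Suc n)"
      if x: "0 \<le> x" for x
    proof -
      have int: "(\<lambda>a. picard_flux n a / cosh a) integrable_on {0..x}"
        by (intro integrable_continuous_interval qc)
      have "0 \<le> picard (Suc n) x"
        unfolding picard_Suc by (intro integral_nonneg int) (use flux[OF c _ b] in auto)
      moreover have "picard (Suc n) x \<le> 1 * x ^ Suc (Suc (2*n)) / fact (Suc (Suc (2*n)))"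
        unfolding picard_Suc
      proof (rule has_integral_le[OF integrable_integral[OF int] has_integral_monomial[OF x]])
        fix t assume t: "t \<in> {0..x}"
        show "picard_flux n t / cosh t \<le> 1 * t ^ Suc (2 * n) / fact (Suc (2 * n))"
          using flux[OF c _ b, of t] t by (simp add: field_simps)
      qed
      ultimately show ?thesis by (simp add: eval_nat_numeral)
    qed
    ultimately show ?case by blast
  qed
  show "continuous_on {0..R} (picard n)"
    "0 \<le> x \<Longrightarrow> 0 \<le> picard n x \<and> picard n x \<le> x ^ (2*n) / fact (2*n)"
    using main[of n] by auto
  show "0 \<le> x \<Longrightarrow> 0 \<le> picard_flux n x \<and> picard_flux n x \<le> cosh x * x ^ Suc (2*n) / fact (Suc (2*n))"
    using main[of n] by (intro flux) auto
  show "continuous_on {0..R} (picard_flux n)"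
    using main[of n] by (intro flux_cont) auto
qed

text \<open>
  \<open>even_sol lam\<close> is the solution of \<open>(cosh y')' = lam cosh y\<close> with \<open>y 0 = 1\<close> and \<open>y' 0 = 0\<close>.
\<close>

definition even_sol :: "complex \<Rightarrow> real \<Rightarrow> complex" where
  "even_sol lam x = (\<Sum>n. of_real (picard n x) * lam ^ n)"

definition even_sol_deriv :: "complex \<Rightarrow> real \<Rightarrow> complex" where
  "even_sol_deriv lam x = (\<Sum>n. of_real (picard_flux n x / cosh x) * lam ^ Suc n)"

lemma summable_exp_like: "summable (\<lambda>n. c * (a::real) ^ n / fact n)"
  using summable_mult[OF summable_exp[of a], of c] by (simp add: divide_inverse mult_ac)

text \<open>Majorants independent of \<open>x\<close> for the M-test. Bounding the factorials below
  by \<open>fact n\<close> turns them into exponential series in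
  \<open>norm lam * R\<^sup>2\<close>, which converge for every \<open>lam\<close>.\<close>

lemma picard_term_bound:
  assumes "x \<in> {0..R}"
  shows "norm (of_real (picard n x) * (lam::complex) ^ n) \<le> 1 * (norm lam * R\<^sup>2) ^ n / fact n"
    and "norm (of_real (picard_flux n x) * (lam::complex) ^ Suc n) \<le>
      (norm lam * cosh R * R) * (norm lam * R\<^sup>2) ^ n / fact n"
    and "norm (of_real (picard_flux n x / cosh x) * (lam::complex) ^ Suc n) \<le>
      (norm lam * R) * (norm lam * R\<^sup>2) ^ n / fact n"
proof -
  have fact_le: "(fact n :: real) \<le> fact (2*n)" "(fact n :: real) \<le> fact (Suc (2*n))"
    by (intro fact_mono; simp)+
  have "picard n x \<le> x ^ (2*n) / fact (2*n)" using picard_continuous_bounds(2) assms by auto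
  also have "\<dots> \<le> R ^ (2*n) / fact n"
    using assms fact_le by (intro frac_le power_mono) auto
  finally have 1: "picard n x \<le> R ^ (2*n) / fact n" .
  have "picard_flux n x \<le> cosh x * (x ^ Suc (2*n) / fact (Suc (2*n)))"
    using picard_continuous_bounds(3) assms by auto
  also have "\<dots> \<le> cosh x * (R ^ Suc (2*n) / fact n)"
    using assms fact_le by (intro frac_le power_mono mult_left_mono) auto
  finally have 2: "picard_flux n x / cosh x \<le> R ^ Suc (2*n) / fact n" by (simp add: field_simps)
  have "picard_flux n x \<le> cosh x * (R ^ Suc (2*n) / fact n)" using 2 by (simp add: field_simps)
  also have "\<dots> \<le> cosh R * (R ^ Suc (2*n) / fact n)"
    using assms by (intro mult_right_mono cosh_real_mono) auto
  finally have 3: "picard_flux n x \<le> cosh R * (R ^ Suc (2*n) / fact n)" .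
  have pos: "0 \<le> picard n x" "0 \<le> picard_flux n x" using picard_continuous_bounds assms by auto
  show "norm (of_real (picard n x) * lam ^ n) \<le> 1 * (norm lam * R\<^sup>2) ^ n / fact n"
    using mult_right_mono[OF 1, of "norm lam ^ n"] pos
    by (simp add: norm_mult norm_power power_mult_distrib power_mult[symmetric] mult_ac)
  show "norm (of_real (picard_flux n x) * lam ^ Suc n) \<le>
      (norm lam * cosh R * R) * (norm lam * R\<^sup>2) ^ n / fact n"
    using mult_right_mono[OF 3, of "norm lam ^ Suc n"] pos
    by (simp add: norm_mult norm_power power_mult_distrib power_mult[symmetric] mult_ac)
  show "norm (of_real (picard_flux n x / cosh x) * lam ^ Suc n) \<le>
      (norm lam * R) * (norm lam * R\<^sup>2) ^ n / fact n"
    using mult_right_mono[OF 2, of "norm lam ^ Suc n"] pos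
    by (simp add: norm_mult norm_power norm_divide power_mult_distrib power_mult[symmetric] mult_ac)
qed

section \<open>Differential equation, holomorphy and zeros of the even solution\<close>

lemma summable_even_sol: "x \<ge> 0 \<Longrightarrow> summable (\<lambda>n. of_real (picard n x) * (lam::complex) ^ n)"
  by (rule summable_comparison_test'[OF summable_exp_like]) (rule picard_term_bound(1)[of x x], simp)

lemma summable_flux: "x \<ge> 0 \<Longrightarrow> summable (\<lambda>n. of_real (picard_flux n x) * (lam::complex) ^ Suc n)"
  by (rule summable_comparison_test'[OF summable_exp_like]) (rule picard_term_bound(2)[of x x], simp)

lemma even_sol_has_derivative:
  assumes "x \<in> {0..R}"
  shows "(even_sol lam has_vector_derivative even_sol_deriv lam x) (at x within {0..R})"
proof -
  \<comment> \<open>The term \<open>picard 0\<close> is constant, so the series of derivatives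
    starts one index later; \<open>M\<close> is shifted in the same way.\<close>
  define f' where "f' = (\<lambda>n x. case n of 0 \<Rightarrow> 0 | Suc m \<Rightarrow> of_real (picard_flux m x / cosh x) * lam ^ Suc m)"
  define M where "M = (\<lambda>n. case n of 0 \<Rightarrow> 0 | Suc m \<Rightarrow> (norm lam * R) * (norm lam * R\<^sup>2) ^ m / fact m)"
  have f'_le: "norm (f' n x) \<le> M n" if "x \<in> {0..R}" for n x
    using picard_term_bound(3)[OF that]
    by (cases n) (simp_all only: f'_def M_def nat.case norm_zero order.refl)
  have M: "summable M"
    by (subst summable_Suc_iff[symmetric]) (simp add: M_def summable_exp_like)
  have "((\<lambda>x. \<Sum>n. of_real (picard n x) * lam ^ n) has_vector_derivative (\<Sum>n. f' n x)) (at x within {0..R})"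
  proof (rule has_vector_derivative_series[where M = M])
    show "((\<lambda>x. of_real (picard n x) * lam ^ n) has_vector_derivative f' n x) (at x within {0..R})"
      if "x \<in> {0..R}" for n x
    proof (cases n)
      case (Suc m)
      have "((\<lambda>x. picard (Suc m) x) has_real_derivative picard_flux m x / cosh x) (at x within {0..R})"
        unfolding picard_Suc
        by (intro integral_has_real_derivative continuous_intros picard_continuous_bounds(4) that) auto
      from has_vector_derivative_mult_left[OF has_vector_derivative_of_real[OF this], of "lam ^ Suc m"]
      show ?thesis using Suc by (simp add: f'_def)
    qed (auto simp: f'_def)
    show "norm (f' n x) \<le> M n" if "x \<in> {0..R}" for n x
      using f'_le[OF that] .
    show "summable M" by (rule M)
    show "summable (\<lambda>n. of_real (picard n x) * lam ^ n)" if "x \<in> {0..R}" for x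
      using that by (intro summable_even_sol) auto
  qed (use assms in auto)
  moreover have "(\<Sum>n. f' n x) = even_sol_deriv lam x"
  proof -
    have "summable (\<lambda>n. f' n x)"
      by (rule summable_comparison_test'[OF M]) (rule f'_le[OF assms])
    from suminf_split_head[OF this] show ?thesis by (simp only: f'_def even_sol_deriv_def nat.case diff_zero)
  qed
  ultimately show ?thesis unfolding even_sol_def[abs_def] by simp
qed

lemma cosh_even_sol_deriv:
  "x \<ge> 0 \<Longrightarrow> of_real (cosh x) * even_sol_deriv lam x = (\<Sum>n. of_real (picard_flux n x) * lam ^ Suc n)"
proof -
  assume "x \<ge> 0"
  have "even_sol_deriv lam x = (\<Sum>n. inverse (of_real (cosh x)) * (of_real (picard_flux n x) * lam ^ Suc n))"
    unfolding even_sol_deriv_def by (intro suminf_cong) (simp add: divide_inverse)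
  also have "\<dots> = inverse (of_real (cosh x)) * (\<Sum>n. of_real (picard_flux n x) * lam ^ Suc n)"
    using summable_flux[OF \<open>x \<ge> 0\<close>] by (rule suminf_mult)
  finally show ?thesis by simp
qed

text \<open>Each flux coefficient has derivative \<open>cosh x * picard n x\<close>, so
  differentiating the flux series returns the series of \<open>even_sol\<close> with the extra
  factor \<open>lam * cosh x\<close>.\<close>

lemma even_sol_ode:
  assumes "x \<in> {0..R}"
  shows "((\<lambda>x. of_real (cosh x) * even_sol_deriv lam x) has_vector_derivative
            lam * of_real (cosh x) * even_sol lam x) (at x within {0..R})"
proof -
  have "((\<lambda>x. \<Sum>n. of_real (picard_flux n x) * lam ^ Suc n) has_vector_derivative
      (\<Sum>n. of_real (cosh x * picard n x) * lam ^ Suc n)) (at x within {0..R})"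
  proof (rule has_vector_derivative_series)
    show "((\<lambda>x. of_real (picard_flux n x) * lam ^ Suc n) has_vector_derivative
        of_real (cosh x * picard n x) * lam ^ Suc n) (at x within {0..R})" if "x \<in> {0..R}" for n x
      unfolding picard_flux_def
      by (intro has_vector_derivative_mult_left has_vector_derivative_of_real
          integral_has_real_derivative continuous_intros picard_continuous_bounds(1) that)
    show "norm (of_real (cosh x * picard n x) * lam ^ Suc n) \<le>
        (cosh R * norm lam) * (norm lam * R\<^sup>2) ^ n / fact n" if "x \<in> {0..R}" for n x
      using mult_mono[OF mult_right_mono[OF cosh_real_mono[of x R], of "norm lam"] picard_term_bound(1)[OF that, of n lam]] that
      by (simp add: norm_mult mult_ac)
    show "summable (\<lambda>n. (cosh R * norm lam) * (norm lam * R\<^sup>2) ^ n / fact n)"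
      by (rule summable_exp_like)
    show "summable (\<lambda>n. of_real (picard_flux n x) * lam ^ Suc n)" if "x \<in> {0..R}" for x
      using that by (intro summable_flux) auto
  qed (use assms in auto)
  moreover have "(\<Sum>n. of_real (cosh x * picard n x) * lam ^ Suc n) = lam * of_real (cosh x) * even_sol lam x"
    unfolding even_sol_def
    using suminf_mult[OF summable_even_sol, of x "lam * of_real (cosh x)" lam] assms
    by (simp add: mult_ac)
  ultimately have *: "((\<lambda>x. \<Sum>n. of_real (picard_flux n x) * lam ^ Suc n) has_vector_derivative
      lam * of_real (cosh x) * even_sol lam x) (at x within {0..R})"
    by (simp only:)
  show ?thesis
    by (rule has_vector_derivative_transform[OF assms _ *]) (rule cosh_even_sol_deriv, simp)
qed

lemma even_sol_0: "even_sol lam 0 = 1"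
proof -
  have "picard n 0 = (if n = 0 then 1 else 0)" for n by (cases n) auto
  hence "even_sol lam 0 = (\<Sum>n. if n = 0 then 1 else 0)"
    unfolding even_sol_def by (intro suminf_cong) auto
  thus ?thesis by (subst (asm) suminf_finite[of "{0}"]) auto
qed

lemma even_sol_deriv_0: "even_sol_deriv lam 0 = 0"
  by (simp add: even_sol_deriv_def picard_flux_def)

lemma continuous_even_sol_deriv: "continuous_on {0..R} (even_sol_deriv lam)"
proof -
  have "continuous_on {0..R} (\<lambda>x. of_real (cosh x) * even_sol_deriv lam x)"
    by (rule continuous_on_vector_derivative, rule even_sol_ode)
  hence "continuous_on {0..R} (\<lambda>x. of_real (cosh x) * even_sol_deriv lam x / of_real (cosh x))"
    by (intro continuous_on_divide) (auto intro!: continuous_intros)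
  moreover have "(\<lambda>x. of_real (cosh x) * even_sol_deriv lam x / of_real (cosh x)) = even_sol_deriv lam"
    by auto
  ultimately show ?thesis by simp
qed

text \<open>Convergence for every \<open>lam\<close> gives holomorphy on each ball about 0, and
  these balls exhaust the plane.\<close>

lemma even_sol_holomorphic: "x \<ge> 0 \<Longrightarrow> (\<lambda>lam. even_sol lam x) holomorphic_on A"
proof -
  assume "x \<ge> 0"
  have "(\<lambda>lam. even_sol lam x) holomorphic_on ball 0 r" for r
    by (rule power_series_holomorphic[of _ _ "\<lambda>n. of_real (picard n x)"])
       (simp add: even_sol_def summable_sums summable_even_sol \<open>x \<ge> 0\<close>)
  hence "(\<lambda>lam. even_sol lam x) holomorphic_on (\<Union>r\<in>UNIV. ball 0 r)"
    by (intro holomorphic_on_UN_open) auto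
  moreover have "(\<Union>r\<in>UNIV. ball (0::complex) r) = UNIV"
    by (auto intro: gt_ex)
  ultimately show ?thesis by (metis holomorphic_on_subset subset_UNIV)
qed

text \<open>The Picard coefficients are nonnegative and the zeroth is 1, so the sum is at least 1.
  This later permits division by \<open>even_sol\<close>.\<close>

lemma even_sol_nonneg_nz:
  assumes "x \<ge> 0" "l \<ge> 0"
  shows "even_sol (of_real l) x \<noteq> 0"
proof -
  have "summable (\<lambda>n. complex_of_real (picard n x * l ^ n))"
    using summable_even_sol[OF assms(1), of "of_real l"] by simp
  hence s: "summable (\<lambda>n. picard n x * l ^ n)"
    using summable_Re by force
  have "even_sol (of_real l) x = of_real (\<Sum>n. picard n x * l ^ n)"
    unfolding even_sol_def using suminf_of_real[OF s, where 'a = complex] by simp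
  moreover have "(\<Sum>n. picard n x * l ^ n) \<ge> (\<Sum>n<1. picard n x * l ^ n)"
    using picard_continuous_bounds(2)[OF assms(1)] assms(2) by (intro sum_le_suminf s) auto
  ultimately show ?thesis by auto
qed

text \<open>The eigenvalue lemma with weight \<open>cosh\<close>; the value 1 at the origin excludes
  both \<open>x = 0\<close> and the zero solution.\<close>

lemma even_sol_zero_imp:
  assumes "x \<ge> 0" "even_sol lam x = 0"
  shows "Im lam = 0" "Re lam \<le> 0"
proof -
  have "x > 0" using assms even_sol_0[of lam] by (cases "x = 0") auto
  have "Im lam = 0 \<and> Re lam \<le> 0"
    using \<open>x > 0\<close> assms(2)
    by (intro sturm_liouville_eigenvalue_nonpos[of x "even_sol lam" "even_sol_deriv lam" cosh])
       (auto simp: even_sol_0 even_sol_deriv_0 cosh_real_pos intro!: even_sol_has_derivative even_sol_ode continuous_even_sol_deriv continuous_intros)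
  thus "Im lam = 0" "Re lam \<le> 0" by auto
qed

section \<open>Integrals of powers\<close>

lemma has_integral_stretch_01:
  fixes f :: "real \<Rightarrow> 'a :: real_normed_vector"
  assumes "m > 0"
  shows "((\<lambda>x. f (m * x)) has_integral I /\<^sub>R m) {0..c} \<longleftrightarrow> (f has_integral I) {0..m * c}"
proof -
  have [simp]: "inverse m * (m * c) = c" using assms by (simp add: field_simps)
  show ?thesis using has_integral_affinity_iff[of m f 0 I 0 "m * c"] assms by simp
qed

lemma has_integral_translate_real:
  fixes f :: "real \<Rightarrow> 'a :: real_normed_vector"
  shows "((\<lambda>x. f (x + c)) has_integral I) {a - c..b - c} \<longleftrightarrow> (f has_integral I) {a..b}"
  using has_integral_affinity_iff[of 1 f c I a b] by simp

lemma has_integral_reflect_about: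
  fixes f :: "real \<Rightarrow> 'a :: real_normed_vector"
  assumes "(f has_integral I) {a..b}"
  shows "((\<lambda>x. f (c - x)) has_integral I) {c - b..c - a}"
  using assms has_integral_translate_real[of "\<lambda>x. f (- x)" "- c" I "- b" "- a"]
    has_integral_reflect_real[of f I a b] by (simp add: algebra_simps)

lemma has_integral_symmetric:
  fixes f :: "real \<Rightarrow> 'a :: banach"
  assumes "c \<ge> 0" and f: "(f has_integral I) {0..c}" and sym: "\<And>x. f (2 * c - x) = f x"
  shows "(f has_integral 2 *\<^sub>R I) {0..2 * c}"
  using has_integral_combine[OF _ _ f, of "2 * c" I] has_integral_reflect_about[OF f, of "2 * c"] assms(1)
  by (simp add: sym scaleR_2)

section \<open>Holomorphic dependence on the exponent\<close>

lemma of_real_powr_eq_exp: "y > 0 \<Longrightarrow> of_real y powr (s::complex) = exp (s * of_real (ln y))"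
  by (simp add: powr_def Ln_of_real)

lemma norm_of_real_powr: "y \<ge> 0 \<Longrightarrow> norm (of_real y powr (s::complex)) = y powr Re s"
  by (simp add: norm_powr_real_powr)

text \<open>With \<open>h = z - s\<close> and \<open>L = ln y\<close>, the norm of
  \<open>exp (h L) - 1\<close> is at most the norm of \<open>h L\<close> times an exponential, and
  the stray factor \<open>L\<close> is absorbed by a second exponential. This dominates difference
  quotients in the exponent by two real powers. At \<open>y = 0\<close> both sides are 0.\<close>

lemma norm_powr_diff_le:
  fixes y \<delta> :: real and z s :: complex
  assumes "y \<ge> 0" "\<delta> > 0" "norm (z - s) \<le> \<delta>"
  shows "norm (of_real y powr z - of_real y powr s) \<le>
           norm (z - s) / \<delta> * (y powr (Re s - 2 * \<delta>) + y powr (Re s + 2 * \<delta>))"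
proof (cases "y = 0")
  case False
  hence y: "y > 0" using assms by simp
  define L where "L = ln y"
  define h where "h = z - s"
  have "norm (exp (h * of_real L) - 1) \<le> exp \<bar>Re (h * of_real L)\<bar> * norm (h * of_real L)"
    using Taylor_exp[of "h * of_real L" 0] by simp
  also have "\<dots> = exp (\<bar>Re h\<bar> * \<bar>L\<bar>) * (norm h * \<bar>L\<bar>)" by (simp add: norm_mult abs_mult)
  also have "\<dots> \<le> exp (\<delta> * \<bar>L\<bar>) * (norm h * \<bar>L\<bar>)"
    using assms(3) abs_Re_le_cmod[of h]
    by (intro mult_right_mono) (auto simp: h_def intro!: mult_right_mono)
  also have "\<dots> = norm h / \<delta> * (exp (\<delta> * \<bar>L\<bar>) * (\<delta> * \<bar>L\<bar>))" using assms by simp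
  also have "\<dots> \<le> norm h / \<delta> * (exp (\<delta> * \<bar>L\<bar>) * exp (\<delta> * \<bar>L\<bar>))"
  proof -
    have "\<delta> * \<bar>L\<bar> \<le> exp (\<delta> * \<bar>L\<bar>)" using exp_ge_add_one_self[of "\<delta> * \<bar>L\<bar>"] by linarith
    thus ?thesis using assms by (intro mult_left_mono) auto
  qed
  also have "exp (\<delta> * \<bar>L\<bar>) * exp (\<delta> * \<bar>L\<bar>) = exp (2 * \<delta> * \<bar>L\<bar>)" by (simp flip: exp_add)
  finally have 1: "norm (exp (h * of_real L) - 1) \<le> norm h / \<delta> * exp (2 * \<delta> * \<bar>L\<bar>)" .
  have "of_real y powr z - of_real y powr s = exp (s * of_real L) * (exp (h * of_real L) - 1)"
  proof -
    have "s * of_real L + h * of_real L = z * of_real L" by (simp add: h_def algebra_simps)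
    hence "exp (s * of_real L) * exp (h * of_real L) = exp (z * of_real L)" by (simp flip: exp_add)
    thus ?thesis using y by (simp add: of_real_powr_eq_exp L_def right_diff_distrib)
  qed
  hence "norm (of_real y powr z - of_real y powr s) = exp (Re s * L) * norm (exp (h * of_real L) - 1)"
    by (simp add: norm_mult)
  also have "\<dots> \<le> exp (Re s * L) * (norm h / \<delta> * exp (2 * \<delta> * \<bar>L\<bar>))"
    using 1 by (intro mult_left_mono) auto
  also have "\<dots> = norm h / \<delta> * exp (Re s * L + 2 * \<delta> * \<bar>L\<bar>)" by (simp add: exp_add)
  \<comment> \<open>The sign of \<open>L\<close> decides which of the two exponentials
    dominates.\<close>
  also have "exp (Re s * L + 2 * \<delta> * \<bar>L\<bar>) \<le> exp ((Re s - 2 * \<delta>) * L) + exp ((Re s + 2 * \<delta>) * L)"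
    by (cases "L \<ge> 0") (simp_all add: algebra_simps add_increasing add_increasing2)
  also have "\<dots> = y powr (Re s - 2 * \<delta>) + y powr (Re s + 2 * \<delta>)"
    using y by (simp add: powr_def L_def)
  finally show ?thesis using assms by (simp add: h_def mult_left_mono divide_right_mono)
qed auto

text \<open>The norm of the integrand is \<open>w x powr Re s\<close>, so only measurability is at
  stake. At zeros of \<open>w\<close> the power takes the default value 0, hence the case
  distinction.\<close>

lemma complex_powr_integrable:
  fixes w :: "real \<Rightarrow> real"
  assumes w: "continuous_on {a..b} w" "\<And>x. x \<in> {a..b} \<Longrightarrow> w x \<ge> 0"
    and int: "(\<lambda>x. w x powr Re s) integrable_on {a..b}"
  shows "(\<lambda>x. complex_of_real (w x) powr s) absolutely_integrable_on {a..b}"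
proof (rule measurable_bounded_by_integrable_imp_absolutely_integrable[OF _ _ int])
  have [measurable]: "w \<in> borel_measurable (lebesgue_on {a..b})"
    by (rule continuous_imp_measurable_on_sets_lebesgue[OF w(1)]) auto
  have "(\<lambda>x. if w x = 0 then 0 else exp (s * complex_of_real (ln (w x)))) \<in> borel_measurable (lebesgue_on {a..b})"
    by measurable
  also have "?this \<longleftrightarrow> (\<lambda>x. complex_of_real (w x) powr s) \<in> borel_measurable (lebesgue_on {a..b})"
  proof (intro measurable_cong)
    fix x assume "x \<in> space (lebesgue_on {a..b})"
    hence "w x \<ge> 0" using w(2) by simp
    thus "(if w x = 0 then 0 else exp (s * complex_of_real (ln (w x)))) = complex_of_real (w x) powr s"
      by (auto simp: of_real_powr_eq_exp)
  qed
  finally show "(\<lambda>x. complex_of_real (w x) powr s) \<in> borel_measurable (lebesgue_on {a..b})" .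
qed (use w(2) in \<open>auto simp: norm_of_real_powr\<close>)

text \<open>Dominated convergence for difference quotients, with the majorant of
  \<open>norm_powr_diff_le\<close>. Where \<open>w x = 0\<close> the integrand is 0 for every
  exponent, and so is \<open>D x\<close>.\<close>

lemma integral_powr_field_differentiable:
  fixes w :: "real \<Rightarrow> real"
  assumes w: "continuous_on {a..b} w" "\<And>x. x \<in> {a..b} \<Longrightarrow> w x \<ge> 0"
    and int: "\<And>\<sigma>. \<bar>\<sigma> - Re s\<bar> \<le> 2 * \<delta> \<Longrightarrow> (\<lambda>x. w x powr \<sigma>) integrable_on {a..b}" and "\<delta> > 0"
  shows "(\<lambda>z. integral {a..b} (\<lambda>x. complex_of_real (w x) powr z)) field_differentiable (at s)"
proof -
  define F where "F = (\<lambda>z. integral {a..b} (\<lambda>x. complex_of_real (w x) powr z))"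
  define D where "D = (\<lambda>x. complex_of_real (w x) powr s * of_real (ln (w x)))"
  define h where "h = (\<lambda>x. 1 / \<delta> * (w x powr (Re s - 2 * \<delta>) + w x powr (Re s + 2 * \<delta>)))"
  have h: "h integrable_on {a..b}"
    unfolding h_def using \<open>\<delta> > 0\<close>
    by (intro integrable_on_cmult_left[where c = "1 / \<delta>" and 'a = real, simplified] integrable_add int
        integrable_on_cmult_iff[THEN iffD2]) auto
  have cint: "(\<lambda>x. complex_of_real (w x) powr z) integrable_on {a..b}" if "z \<in> ball s \<delta>" for z
  proof -
    have "\<bar>Re z - Re s\<bar> \<le> norm (z - s)" using abs_Re_le_cmod[of "z - s"] by simp
    also have "\<dots> \<le> 2 * \<delta>" using that \<open>\<delta> > 0\<close> by (simp add: dist_norm norm_minus_commute)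
    finally show ?thesis
      using complex_powr_integrable[OF w, of z] int by (simp add: absolutely_integrable_on_def)
  qed
  have "((\<lambda>z. (F z - F s) / (z - s)) \<longlongrightarrow> integral {a..b} D) (at s within ball s \<delta>)"
    unfolding tendsto_at_iff_sequentially
  proof (intro allI impI)
    fix X assume X: "\<forall>i. X i \<in> ball s \<delta> - {s}" "X \<longlonglongrightarrow> s"
    define q where "q = (\<lambda>n x. (complex_of_real (w x) powr X n - of_real (w x) powr s) / (X n - s))"
    have qint: "q n integrable_on {a..b}" for n
      unfolding q_def using X \<open>\<delta> > 0\<close> by (intro integrable_on_divide integrable_diff cint) auto
    have "(\<lambda>n. integral {a..b} (q n)) \<longlonglongrightarrow> integral {a..b} D"
    proof (rule dominated_convergence(2)[OF qint h])
      fix n x assume x: "x \<in> {a..b}"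
      have *: "norm (X n - s) \<le> \<delta>" "X n \<noteq> s"
        using X(1) by (auto simp: dist_norm norm_minus_commute intro: less_imp_le)
      show "norm (q n x) \<le> h x"
        using norm_powr_diff_le[OF w(2)[OF x] \<open>\<delta> > 0\<close> *(1)] *(2)
        by (simp add: q_def h_def norm_divide divide_le_eq mult_ac)
    next
      fix x assume x: "x \<in> {a..b}"
      have "((\<lambda>z. complex_of_real (w x) powr z) has_field_derivative D x) (at s)"
      proof (cases "w x = 0")
        case False
        hence "w x > 0" using w(2)[OF x] by simp
        thus ?thesis unfolding D_def
          by (auto intro!: derivative_eq_intros simp: Ln_of_real)
      qed (simp add: D_def)
      hence "((\<lambda>z. (complex_of_real (w x) powr z - complex_of_real (w x) powr s) / (z - s)) \<longlongrightarrow> D x) (at s)"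
        by (simp add: has_field_derivative_iff)
      thus "(\<lambda>n. q n x) \<longlonglongrightarrow> D x"
        unfolding tendsto_at_iff_sequentially q_def using X by (auto simp: o_def)
    qed
    moreover have "integral {a..b} (q n) = (F (X n) - F s) / (X n - s)" for n
      unfolding q_def F_def using cint[of "X n"] cint[of s] X \<open>\<delta> > 0\<close>
      by (subst integral_divide) (auto simp: integral_diff)
    ultimately show "((\<lambda>z. (F z - F s) / (z - s)) \<circ> X) \<longlonglongrightarrow> integral {a..b} D"
      by (simp add: o_def)
  qed
  hence "(F has_field_derivative integral {a..b} D) (at s within ball s \<delta>)"
    by (simp add: has_field_derivative_iff)
  moreover have "at s within ball s \<delta> = at s"
    using \<open>\<delta> > 0\<close> by (intro at_within_open) auto
  ultimately show ?thesis unfolding F_def field_differentiable_def by auto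
qed

lemma integral_powr_holomorphic:
  fixes w :: "real \<Rightarrow> real"
  assumes w: "continuous_on {a..b} w" "\<And>x. x \<in> {a..b} \<Longrightarrow> w x \<ge> 0"
    and int: "\<And>\<sigma>. \<sigma> > c \<Longrightarrow> (\<lambda>x. w x powr \<sigma>) integrable_on {a..b}"
  shows "(\<lambda>z. integral {a..b} (\<lambda>x. complex_of_real (w x) powr z)) holomorphic_on {s. Re s > c}"
  unfolding holomorphic_on_def
proof (rule ballI, rule field_differentiable_at_within)
  fix s assume "s \<in> {s. Re s > c}"
  hence s: "Re s > c" by simp
  show "(\<lambda>z. integral {a..b} (\<lambda>x. complex_of_real (w x) powr z)) field_differentiable (at s)"
  proof (rule integral_powr_field_differentiable[OF w])
    \<comment> \<open>Exponents within half the distance from \<open>Re s\<close> to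
      \<open>c\<close> stay above \<open>c\<close>.\<close>
    show "(\<lambda>x. w x powr \<sigma>) integrable_on {a..b}" if "\<bar>\<sigma> - Re s\<bar> \<le> 2 * ((Re s - c) / 4)" for \<sigma>
    proof (rule int)
      have "Re s - \<sigma> \<le> \<bar>\<sigma> - Re s\<bar>" by linarith
      also note that
      finally have "2 * (Re s - \<sigma>) \<le> Re s - c" by (simp add: field_simps)
      thus "\<sigma> > c" using s by argo
    qed
  next
    show "(Re s - c) / 4 > 0" using s by argo
  qed
qed

text \<open>Comparison with \<open>1 / x\<close>, whose integral over
  \<open>{d * exp (- n)..d}\<close> is exactly \<open>n\<close>; \<open>d <= 1\<close> makes
  \<open>x powr \<sigma>\<close> the larger function.\<close>

lemma not_integrable_powr_from_0:
  assumes "c > 0" "\<sigma> \<le> - 1"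
  shows "\<not> (\<lambda>x::real. x powr \<sigma>) integrable_on {0..c}"
proof
  assume int: "(\<lambda>x::real. x powr \<sigma>) integrable_on {0..c}"
  define d where "d = min c 1"
  have d: "0 < d" "d \<le> c" "d \<le> 1" using assms by (auto simp: d_def)
  have int': "(\<lambda>x. x powr \<sigma>) integrable_on {e..d}" if "0 \<le> e" for e
    using int by (rule integrable_subinterval_real) (use d that in auto)
  define I where "I = integral {0..d} (\<lambda>x::real. x powr \<sigma>)"
  have "real n \<le> I" for n
  proof -
    define e where "e = d * exp (- real n)"
    have e: "0 < e" "e \<le> d" using d by (auto simp: e_def mult_le_cancel_left1)
    have inv: "((\<lambda>x. 1 / x) has_integral ln d - ln e) {e..d}"
      by (rule fundamental_theorem_of_calculus)
         (use e in \<open>auto intro!: derivative_eq_intros simp: has_real_derivative_iff_has_vector_derivative[symmetric]\<close>)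
    have "real n = ln d - ln e" using d by (simp add: e_def ln_mult)
    also have "\<dots> \<le> integral {e..d} (\<lambda>x. x powr \<sigma>)"
    proof (rule has_integral_le[OF inv integrable_integral[OF int']])
      fix x assume x: "x \<in> {e..d}"
      hence "1 / x = x powr (- 1)" using e by (simp add: powr_minus_divide)
      also have "\<dots> \<le> x powr \<sigma>" using x e d assms by (intro powr_mono') auto
      finally show "1 / x \<le> x powr \<sigma>" .
    qed (use e in auto)
    also have "\<dots> \<le> I" unfolding I_def
      by (intro integral_subset_le int') (use e in auto)
    finally show ?thesis .
  qed
  from this[of "nat \<lceil>I\<rceil> + 1"] show False by linarith
qed

section \<open>Integrability near the zeros\<close>

text \<open>The negated difference quotient of \<open>cos\<close> at \<open>\<phi>\<close>,
  completed by \<open>sin \<phi>\<close>, is continuous, and positive on \<open>{0..pi}\<close>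
  because \<open>cos\<close> decreases strictly there. Its minimum serves as
  \<open>c\<close>.\<close>

lemma cos_diff_bounds:
  assumes "\<phi> \<in> {0<..<pi}"
  obtains c where "c > 0" "\<And>x. x \<in> {0..pi} \<Longrightarrow> c * \<bar>x - \<phi>\<bar> \<le> \<bar>cos x - cos \<phi>\<bar>"
    "\<And>x. \<bar>cos x - cos \<phi>\<bar> \<le> \<bar>x - \<phi>\<bar>"
proof -
  define F where "F = (\<lambda>x. if x = \<phi> then sin \<phi> else (cos \<phi> - cos x) / (x - \<phi>))"
  have "(cos has_real_derivative - sin \<phi>) (at \<phi>)" by (rule DERIV_cos)
  hence "((\<lambda>x. (cos x - cos \<phi>) / (x - \<phi>)) \<longlongrightarrow> - sin \<phi>) (at \<phi>)"
    by (simp add: has_field_derivative_iff)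
  from tendsto_minus[OF this] have lim: "((\<lambda>x. (cos \<phi> - cos x) / (x - \<phi>)) \<longlongrightarrow> sin \<phi>) (at \<phi>)"
    by (simp add: minus_divide_left)
  have F: "isCont F x" for x
  proof (cases "x = \<phi>")
    case True
    have "(F \<longlongrightarrow> sin \<phi>) (at \<phi>)"
      by (rule Lim_transform_eventually[OF lim]) (auto simp: F_def eventually_at_filter)
    thus ?thesis using True by (simp add: isCont_def F_def)
  next
    case False
    have "isCont (\<lambda>x. (cos \<phi> - cos x) / (x - \<phi>)) x" using False by (intro continuous_intros) auto
    moreover have "eventually (\<lambda>y. F y = (cos \<phi> - cos y) / (y - \<phi>)) (nhds x)"
      using t1_space_nhds[OF False] by eventually_elim (auto simp: F_def)
    ultimately show ?thesis by (simp add: isCont_cong)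
  qed
  have "\<exists>x\<in>{0..pi}. \<forall>y\<in>{0..pi}. F x \<le> F y"
    by (intro continuous_attains_inf continuous_at_imp_continuous_on) (auto simp: F)
  then obtain z where z: "z \<in> {0..pi}" "\<And>y. y \<in> {0..pi} \<Longrightarrow> F z \<le> F y" by blast
  have Fpos: "F x > 0" if "x \<in> {0..pi}" for x
  proof -
    consider "x = \<phi>" | "x < \<phi>" | "x > \<phi>" by linarith
    thus ?thesis
    proof cases
      case 1
      thus ?thesis using assms by (simp add: F_def sin_gt_zero)
    next
      case 2
      hence "cos \<phi> < cos x" using that assms by (intro cos_monotone_0_pi) auto
      thus ?thesis using 2 by (simp add: F_def divide_neg_neg)
    next
      case 3
      hence "cos x < cos \<phi>" using that assms by (intro cos_monotone_0_pi) auto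
      thus ?thesis using 3 by (simp add: F_def)
    qed
  qed
  show thesis
  proof (rule that[of "F z"])
    show "F z > 0" using Fpos z by blast
    show "F z * \<bar>x - \<phi>\<bar> \<le> \<bar>cos x - cos \<phi>\<bar>" if "x \<in> {0..pi}" for x
    proof (cases "x = \<phi>")
      case False
      have "F z \<le> \<bar>F x\<bar>" using z(2)[OF that] by linarith
      thus ?thesis using False by (simp add: F_def divide_simps abs_minus_commute split: if_splits)
    qed auto
    show "\<bar>cos x - cos \<phi>\<bar> \<le> \<bar>x - \<phi>\<bar>" for x
    proof -
      have "\<bar>cos x - cos \<phi>\<bar> = 2 * \<bar>sin ((x + \<phi>) / 2)\<bar> * \<bar>sin ((\<phi> - x) / 2)\<bar>"
        by (simp add: cos_diff_cos abs_mult)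
      also have "\<dots> \<le> 2 * 1 * \<bar>(\<phi> - x) / 2\<bar>"
        by (intro mult_mono abs_sin_le_one abs_sin_x_le_abs_x) auto
      finally show ?thesis by simp
    qed
  qed
qed

text \<open>Translation and reflection move the singularity to the endpoint 0 of an interval; for
  divergence one side suffices.\<close>

lemma integrable_abs_diff_powr_iff:
  fixes a b \<phi> \<sigma> :: real
  assumes "a < \<phi>" "\<phi> < b"
  shows "(\<lambda>x. \<bar>x - \<phi>\<bar> powr \<sigma>) integrable_on {a..b} \<longleftrightarrow> \<sigma> > - 1"
proof
  assume "(\<lambda>x. \<bar>x - \<phi>\<bar> powr \<sigma>) integrable_on {a..b}"
  hence "(\<lambda>x. \<bar>x - \<phi>\<bar> powr \<sigma>) integrable_on {\<phi>..b}"
    by (rule integrable_subinterval_real) (use assms in auto)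
  then obtain I where "((\<lambda>x. \<bar>x - \<phi>\<bar> powr \<sigma>) has_integral I) {\<phi>..b}" by blast
  hence "((\<lambda>x. \<bar>x + \<phi> - \<phi>\<bar> powr \<sigma>) has_integral I) {\<phi> - \<phi>..b - \<phi>}"
    by (subst has_integral_translate_real)
  hence "((\<lambda>x. x powr \<sigma>) has_integral I) {0..b - \<phi>}"
    by (subst has_integral_cong[of _ _ "\<lambda>x. \<bar>x + \<phi> - \<phi>\<bar> powr \<sigma>"]) auto
  thus "\<sigma> > - 1" using not_integrable_powr_from_0[of "b - \<phi>" \<sigma>] assms by force
next
  assume \<sigma>: "\<sigma> > - 1"
  have *: "(\<lambda>x. \<bar>x\<bar> powr \<sigma>) integrable_on {0..c}" if "c \<ge> 0" for c
    using integrable_on_powr_from_0[OF \<sigma> that] by (rule integrable_eq) auto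
  have right: "(\<lambda>x. \<bar>x - \<phi>\<bar> powr \<sigma>) integrable_on {\<phi>..b}"
  proof -
    obtain I where "((\<lambda>x. \<bar>x\<bar> powr \<sigma>) has_integral I) {0..b - \<phi>}" using *[of "b - \<phi>"] assms by fastforce
    thus ?thesis
      using has_integral_translate_real[of "\<lambda>x. \<bar>x\<bar> powr \<sigma>" "- \<phi>" I 0 "b - \<phi>"] by auto
  qed
  have left: "(\<lambda>x. \<bar>x - \<phi>\<bar> powr \<sigma>) integrable_on {a..\<phi>}"
  proof -
    obtain I where "((\<lambda>x. \<bar>x\<bar> powr \<sigma>) has_integral I) {0..\<phi> - a}" using *[of "\<phi> - a"] assms by fastforce
    from has_integral_reflect_about[OF this, of \<phi>] show ?thesis
      by (auto simp: abs_minus_commute)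
  qed
  show "(\<lambda>x. \<bar>x - \<phi>\<bar> powr \<sigma>) integrable_on {a..b}"
    by (rule Henstock_Kurzweil_Integration.integrable_combine[OF _ _ left right]) (use assms in auto)
qed

text \<open>The modulus of \<open>k + x + 1/x\<close> at the point \<open>x = cis t\<close> of the
  unit circle.\<close>

definition rcos :: "real \<Rightarrow> real \<Rightarrow> real" where "rcos k t = \<bar>k + 2 * cos t\<bar>"

lemma continuous_rcos: "continuous_on A (rcos k)"
  unfolding rcos_def by (intro continuous_intros)

lemma rcos_nonneg: "rcos k t \<ge> 0"
  by (simp add: rcos_def)

lemma powr_measurable_lebesgue_on:
  fixes w :: "real \<Rightarrow> real"
  assumes "continuous_on {a..b} w"
  shows "(\<lambda>x. w x powr \<sigma>) \<in> borel_measurable (lebesgue_on {a..b})"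
proof -
  have [measurable]: "w \<in> borel_measurable (lebesgue_on {a..b})"
    by (rule continuous_imp_measurable_on_sets_lebesgue[OF assms]) auto
  show ?thesis by measurable
qed

text \<open>For these \<open>k\<close> there is a single zero \<open>\<phi>\<close> in
  \<open>{0..pi}\<close>, which is interior and simple, so \<open>rcos k t\<close> is comparable to
  the distance from \<open>t\<close> to \<open>\<phi>\<close>.\<close>

lemma rcos_powr_integrable_iff:
  assumes "\<bar>k\<bar> < 2"
  shows "(\<lambda>t. rcos k t powr \<sigma>) integrable_on {0..pi} \<longleftrightarrow> \<sigma> > - 1"
proof -
  define \<phi> where "\<phi> = arccos (- k / 2)"
  have \<phi>: "\<phi> \<in> {0<..<pi}" and cos_\<phi>: "cos \<phi> = - k / 2"
    using assms arccos_lt_bounded[of "- k / 2"] by (auto simp: \<phi>_def cos_arccos)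
  obtain c where c: "c > 0" "\<And>x. x \<in> {0..pi} \<Longrightarrow> c * \<bar>x - \<phi>\<bar> \<le> \<bar>cos x - cos \<phi>\<bar>"
    "\<And>x. \<bar>cos x - cos \<phi>\<bar> \<le> \<bar>x - \<phi>\<bar>"
    using cos_diff_bounds[OF \<phi>] by metis
  have "rcos k t = \<bar>2 * (cos t - cos \<phi>)\<bar>" for t
    by (simp add: rcos_def cos_\<phi> algebra_simps)
  hence rcos: "rcos k t = 2 * \<bar>cos t - cos \<phi>\<bar>" for t
    by (simp only: abs_mult)
  have iff: "(\<lambda>x. \<bar>x - \<phi>\<bar> powr \<sigma>) integrable_on {0..pi} \<longleftrightarrow> \<sigma> > - 1"
    using \<phi> by (intro integrable_abs_diff_powr_iff) auto
  show ?thesis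
  \<comment> \<open>As \<open>0 powr 0 = 0\<close>, the integrand is discontinuous for \<open>\<sigma> = 0\<close>.\<close>
  proof (cases "\<sigma> > 0")
    case True
    have "(\<lambda>t. rcos k t powr \<sigma>) integrable_on {0..pi}"
      using True rcos_nonneg by (intro integrable_continuous_interval continuous_on_powr' continuous_rcos continuous_intros) auto
    thus ?thesis using True by simp
  next
    case False
    hence \<sigma>: "\<sigma> \<le> 0" by simp
    have up: "norm (rcos k t powr \<sigma>) \<le> (2 * c) powr \<sigma> * \<bar>t - \<phi>\<bar> powr \<sigma>" if "t \<in> {0..pi}" for t
    proof (cases "t = \<phi>")
      case False
      have "rcos k t powr \<sigma> \<le> (2 * c * \<bar>t - \<phi>\<bar>) powr \<sigma>"
        using c(1) c(2)[OF that] \<sigma> False by (intro powr_mono2') (auto simp: rcos)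
      thus ?thesis using c(1) by (simp add: powr_mult)
    qed (simp add: rcos)
    have lo: "norm (\<bar>t - \<phi>\<bar> powr \<sigma>) \<le> 2 powr (- \<sigma>) * rcos k t powr \<sigma>" if "t \<in> {0..pi}" for t
    proof (cases "t = \<phi>")
      case False
      hence "\<bar>cos t - cos \<phi>\<bar> > 0" using c(1) c(2)[OF that] by (smt (verit) mult_pos_pos)
      hence "\<bar>t - \<phi>\<bar> powr \<sigma> \<le> \<bar>cos t - cos \<phi>\<bar> powr \<sigma>"
        using c(3)[of t] \<sigma> by (intro powr_mono2') auto
      thus ?thesis by (simp add: rcos powr_mult powr_minus mult.assoc[symmetric])
    qed (simp add: rcos)
    show ?thesis
    proof
      assume "(\<lambda>t. rcos k t powr \<sigma>) integrable_on {0..pi}"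
      hence "(\<lambda>t. 2 powr (- \<sigma>) * rcos k t powr \<sigma>) integrable_on {0..pi}" by simp
      hence "(\<lambda>t. \<bar>t - \<phi>\<bar> powr \<sigma>) integrable_on {0..pi}"
        by (rule measurable_bounded_by_integrable_imp_integrable[rotated 1])
           (use lo in \<open>auto intro!: powr_measurable_lebesgue_on continuous_intros\<close>)
      thus "\<sigma> > - 1" using iff by simp
    next
      assume "\<sigma> > - 1"
      hence "(\<lambda>t. (2 * c) powr \<sigma> * \<bar>t - \<phi>\<bar> powr \<sigma>) integrable_on {0..pi}" using iff c(1) by simp
      thus "(\<lambda>t. rcos k t powr \<sigma>) integrable_on {0..pi}"
        by (rule measurable_bounded_by_integrable_imp_integrable[rotated 1])
           (use up in \<open>auto intro!: powr_measurable_lebesgue_on continuous_rcos\<close>)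
    qed
  qed
qed

text \<open>The substitution \<open>x = (cos t)\<^sup>2\<close> in Euler's Beta integral yields
  twice the integral over a quarter period; reflection about \<open>pi / 2\<close> gives the other
  quarter.\<close>

lemma abs_cos_powr_has_integral:
  assumes "a > 0"
  shows "((\<lambda>t. \<bar>cos t\<bar> powr a) has_integral Beta ((a + 1) / 2) (1 / 2)) {0..pi}"
proof -
  define f where "f = (\<lambda>x::real. x powr ((a + 1) / 2 - 1) * (1 - x) powr (1 / 2 - 1))"
  let ?B = "Beta ((a + 1) / 2) (1 / 2 :: real)"
  have "(f has_integral ?B) {0..1}"
    unfolding f_def using assms by (intro has_integral_Beta_real) auto
  hence f: "(f has_integral ?B) {0<..<1}" by (simp add: has_integral_Icc_iff_Ioo)
  define g where "g = (\<lambda>t::real. (cos t)\<^sup>2)"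
  define g' where "g' = (\<lambda>t::real. - 2 * cos t * sin t)"
  define S where "S = {0<..<pi/2}"
  have cs: "cos t > 0" "sin t > 0" if "t \<in> S" for t
    using that by (auto simp: S_def intro!: cos_gt_zero sin_gt_zero)
  have sq_powr: "(y\<^sup>2) powr b = y powr (2 * b)" if "y > 0" for y b :: real
    using powr_powr[of y 2 b] that by simp
  have der: "(g has_field_derivative g' t) (at t within S)" for t
    unfolding g_def g'_def by (auto intro!: derivative_eq_intros)
  have inj: "inj_on g S"
  proof (rule inj_onI)
    fix x y assume xy: "x \<in> S" "y \<in> S" "g x = g y"
    hence "cos x = cos y" using cs[of x] cs[of y] by (simp add: g_def power2_eq_iff)
    thus "x = y" using xy by (intro cos_inj_pi[of x y]) (auto simp: S_def)
  qed
  have img: "g ` S = {0<..<1}"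
  proof
    show "g ` S \<subseteq> {0<..<1}"
    proof
      fix y assume "y \<in> g ` S"
      then obtain t where t: "t \<in> S" "y = g t" by blast
      have "g t = 1 - (sin t)\<^sup>2" by (simp add: g_def cos_squared_eq)
      moreover have "(sin t)\<^sup>2 > 0" "g t > 0" using cs[OF t(1)] by (auto simp: g_def)
      ultimately show "y \<in> {0<..<1}" using t by simp
    qed
    show "{0<..<1} \<subseteq> g ` S"
    proof
      fix y :: real assume y: "y \<in> {0<..<1}"
      hence sq: "0 < sqrt y" "sqrt y < 1" by auto
      hence "- 1 < sqrt y" by linarith
      have "arccos (sqrt y) \<in> S" unfolding S_def
        using sq \<open>- 1 < sqrt y\<close> arccos_less_arccos[of 0 "sqrt y"] arccos_lt_bounded[of "sqrt y"] by auto
      moreover have "g (arccos (sqrt y)) = y"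
        using y sq \<open>- 1 < sqrt y\<close> by (simp add: g_def cos_arccos)
      ultimately show "y \<in> g ` S" by (metis image_eqI)
    qed
  qed
  have fabs: "f absolutely_integrable_on {0<..<1}"
    using f by (intro nonnegative_absolutely_integrable_1) (auto simp: f_def)
  have "(\<lambda>t. \<bar>g' t\<bar> * f (g t)) absolutely_integrable_on S \<and> integral S (\<lambda>t. \<bar>g' t\<bar> * f (g t)) = ?B"
    using has_absolute_integral_change_of_variables_1'[of S g g' f ?B] der inj fabs f img
    by (auto simp: S_def integral_unique)
  hence "((\<lambda>t. \<bar>g' t\<bar> * f (g t)) has_integral ?B) S"
    by (metis absolutely_integrable_on_def integrable_integral)
  \<comment> \<open>The \<open>sin t\<close> of the Jacobian cancels the factor
    \<open>(1 - x) powr (- 1/2)\<close>, leaving a pure power of \<open>cos t\<close>.\<close>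
  moreover have "\<bar>g' t\<bar> * f (g t) = 2 * \<bar>cos t\<bar> powr a" if "t \<in> S" for t
  proof -
    have "f (g t) = (cos t ^ 2) powr ((a - 1) / 2) * (sin t ^ 2) powr (- (1/2))"
    proof -
      have "(a + 1) / 2 - 1 = (a - 1) / 2" "1 / 2 - 1 = - (1 / 2 :: real)" by (simp_all add: field_simps)
      thus ?thesis unfolding f_def g_def sin_squared_eq by (simp only:)
    qed
    also have "\<dots> = cos t powr (a - 1) * sin t powr (- 1)"
    proof -
      have "2 * ((a - 1) / 2) = a - 1" "2 * - (1/2) = (- 1 :: real)" by simp_all
      thus ?thesis unfolding sq_powr[OF cs(1)[OF that]] sq_powr[OF cs(2)[OF that]] by (simp only:)
    qed
    finally have "\<bar>g' t\<bar> * f (g t) = 2 * (cos t powr 1 * cos t powr (a - 1)) * (sin t powr 1 * sin t powr (- 1))"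
      using cs[OF that] by (simp add: g'_def abs_mult)
    also have "\<dots> = 2 * cos t powr a" using cs[OF that] unfolding powr_add[symmetric] by simp
    finally show ?thesis using cs[OF that] by simp
  qed
  ultimately have "((\<lambda>t. 2 * \<bar>cos t\<bar> powr a) has_integral ?B) S"
    by (subst has_integral_cong[of S _ "\<lambda>t. \<bar>g' t\<bar> * f (g t)"]) auto
  hence "((\<lambda>t. 2 * \<bar>cos t\<bar> powr a) has_integral ?B) {0..pi/2}"
    unfolding S_def by (simp only: has_integral_Icc_iff_Ioo)
  from has_integral_mult_right[OF this, of "1/2"]
  have "((\<lambda>t. \<bar>cos t\<bar> powr a) has_integral ?B / 2) {0..pi/2}" by simp
  from has_integral_symmetric[OF _ this] show ?thesis by simp
qed

section \<open>The meromorphic continuation\<close>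

lemma W1_integrand_circlepath:
  "W1_integrand k s (circlepath 0 1 t) * vector_derivative (circlepath 0 1) (at t) =
     2 * complex_of_real pi * \<i> * (of_real (rcos k (2 * pi * t)) powr s)"
proof -
  define z where "z = cis (2 * pi * t)"
  have z: "circlepath 0 1 t = z" "z \<noteq> 0" 
    by (simp_all add: circlepath z_def cis_conv_exp mult_ac)
  have "vector_derivative (circlepath 0 1) (at t) = 2 * complex_of_real pi * \<i> * z"
    unfolding circlepath_def vector_derivative_part_circlepath
    by (simp add: z_def cis_conv_exp linepath_def mult_ac)
  moreover have "of_real k + z + inverse z = of_real (k + 2 * cos (2 * pi * t))"
    by (simp add: z_def complex_eq_iff)
  hence "cmod (of_real k + z + inverse z) = rcos k (2 * pi * t)"
    by (simp only: norm_of_real rcos_def)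
  ultimately show ?thesis using z by (simp add: W1_integrand_def)
qed

text \<open>\<open>cos\<close> is symmetric about \<open>pi\<close>, so a full period counts the
  half period twice. A general \<open>h\<close> covers real and complex powers alike.\<close>

lemma has_integral_rcos_period:
  fixes h :: "real \<Rightarrow> 'a :: banach"
  assumes "((\<lambda>t. h (rcos k t)) has_integral I) {0..pi}"
  shows "((\<lambda>t. h (rcos k (2 * pi * t))) has_integral I /\<^sub>R pi) {0..1}"
proof -
  have "((\<lambda>t. h (rcos k t)) has_integral 2 *\<^sub>R I) {0..2 * pi * 1}"
    using has_integral_symmetric[OF _ assms] by (simp add: rcos_def)
  hence "((\<lambda>t. h (rcos k (2 * pi * t))) has_integral (2 *\<^sub>R I) /\<^sub>R (2 * pi)) {0..1}"
    by (subst has_integral_stretch_01[of "2 * pi" "\<lambda>t. h (rcos k t)"]) auto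
  thus ?thesis by simp
qed

text \<open>The norm of a complex power of a nonnegative real depends on \<open>Re s\<close> alone,
  so absolute convergence becomes integrability of a nonnegative real function.\<close>

lemma W1_converges_iff: "W1_converges k s \<longleftrightarrow> (\<lambda>t. rcos k t powr Re s) integrable_on {0..pi}"
proof
  assume "W1_converges k s"
  hence "(\<lambda>t. norm (2 * complex_of_real pi * \<i> * (of_real (rcos k (2 * pi * t)) powr s))) integrable_on {0..1}"
    unfolding W1_converges_def W1_integrand_circlepath absolutely_integrable_on_def by blast
  hence "(\<lambda>t. rcos k (2 * pi * t) powr Re s) integrable_on {0..1}"
    by (simp add: norm_mult norm_of_real_powr rcos_nonneg)
  hence "(\<lambda>t. rcos k (2 * pi * t) powr Re s) integrable_on {0..1/2}"
    by (rule integrable_subinterval_real) auto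
  then obtain I where "((\<lambda>t. rcos k (2 * pi * t) powr Re s) has_integral I) {0..1/2}" by blast
  thus "(\<lambda>t. rcos k t powr Re s) integrable_on {0..pi}"
    using has_integral_stretch_01[of "2 * pi" "\<lambda>t. rcos k t powr Re s" "2 * pi * I" "1/2"]
    by (auto simp: field_simps)
next
  assume "(\<lambda>t. rcos k t powr Re s) integrable_on {0..pi}"
  then obtain I where "((\<lambda>t. rcos k t powr Re s) has_integral I) {0..pi}" by blast
  from has_integral_rcos_period[where h = "\<lambda>x. x powr Re s", OF this]
  have "(\<lambda>t. rcos k (2 * pi * t) powr Re s) integrable_on {0..1}" by blast
  moreover have "continuous_on {0..1} (\<lambda>t. rcos k (2 * pi * t))"
    unfolding rcos_def by (intro continuous_intros)
  ultimately have "(\<lambda>t. complex_of_real (rcos k (2 * pi * t)) powr s) absolutely_integrable_on {0..1}"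
    by (intro complex_powr_integrable) (auto simp: rcos_nonneg)
  thus "W1_converges k s"
    unfolding W1_converges_def W1_integrand_circlepath by (rule set_integrable_mult_right)
qed

definition rcos_moment :: "real \<Rightarrow> complex \<Rightarrow> complex" where
  "rcos_moment k s = integral {0..pi} (\<lambda>t. of_real (rcos k t) powr s)"

lemma rcos_moment_has_integral:
  assumes "(\<lambda>t. rcos k t powr Re s) integrable_on {0..pi}"
  shows "((\<lambda>t. complex_of_real (rcos k t) powr s) has_integral rcos_moment k s) {0..pi}"
  using complex_powr_integrable[OF continuous_rcos _ assms] rcos_nonneg
  by (auto simp: rcos_moment_def absolutely_integrable_on_def intro: integrable_integral)

lemma W1_integral_eq:
  assumes "W1_converges k s"
  shows "W1_integral k s = rcos_moment k s / of_real pi"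
proof -
  from assms have "((\<lambda>t. complex_of_real (rcos k t) powr s) has_integral rcos_moment k s) {0..pi}"
    unfolding W1_converges_iff by (rule rcos_moment_has_integral)
  from has_integral_rcos_period[where h = "\<lambda>x. complex_of_real x powr s", OF this]
  have "((\<lambda>t. 2 * complex_of_real pi * \<i> * (of_real (rcos k (2 * pi * t)) powr s)) has_integral
          2 * complex_of_real pi * \<i> * (rcos_moment k s /\<^sub>R pi)) {0..1}"
    by (rule has_integral_mult_right)
  hence "contour_integral (circlepath 0 1) (W1_integrand k s) =
          2 * complex_of_real pi * \<i> * (rcos_moment k s /\<^sub>R pi)"
    unfolding contour_integral_integral W1_integrand_circlepath by (rule integral_unique)
  thus ?thesis by (simp add: W1_integral_def scaleR_conv_of_real field_simps)
qed

lemma rcos_powr_integrable_nonneg: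
  assumes "\<sigma> > 0"
  shows "(\<lambda>t. rcos k t powr \<sigma>) integrable_on {0..pi}"
  using assms rcos_nonneg
  by (intro integrable_continuous_interval continuous_on_powr' continuous_rcos continuous_intros) auto

lemma has_integral_rcos_minus:
  fixes h :: "real \<Rightarrow> 'a :: banach"
  assumes "((\<lambda>t. h (rcos k t)) has_integral I) {0..pi}"
  shows "((\<lambda>t. h (rcos (- k) t)) has_integral I) {0..pi}"
proof -
  have "rcos k (pi - t) = rcos (- k) t" for t
    unfolding rcos_def using abs_minus_cancel[of "- k + 2 * cos t"] by simp
  thus ?thesis using has_integral_reflect_about[OF assms, of pi] by simp
qed

lemma W1_converges_minus: "W1_converges (- k) s \<longleftrightarrow> W1_converges k s"
  using has_integral_rcos_minus[of "\<lambda>x. x powr Re s" k] has_integral_rcos_minus[of "\<lambda>x. x powr Re s" "- k"]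
  by (auto simp: W1_converges_iff integrable_on_def)

text \<open>The reflection of \<open>t\<close> to \<open>pi - t\<close> exchanges \<open>k\<close>
  and \<open>- k\<close>, so both parameters impose the same defining property on the
  continuation.\<close>

lemma W1_minus: "W1 (- k) = W1 k"
proof -
  have "W1_integral (- k) s = W1_integral k s" if conv: "W1_converges k s" for s
  proof -
    have conv': "W1_converges (- k) s" using conv by (simp add: W1_converges_minus)
    have "((\<lambda>t. complex_of_real (rcos k t) powr s) has_integral rcos_moment k s) {0..pi}"
      using conv unfolding W1_converges_iff by (rule rcos_moment_has_integral)
    from has_integral_rcos_minus[where h = "\<lambda>x. complex_of_real x powr s", OF this]
    have "rcos_moment (- k) s = rcos_moment k s"
      unfolding rcos_moment_def by (rule integral_unique)
    thus ?thesis by (simp add: W1_integral_eq conv conv')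
  qed
  hence "(\<forall>s. W1_converges (- k) s \<longrightarrow> W s = W1_integral (- k) s) \<longleftrightarrow>
         (\<forall>s. W1_converges k s \<longrightarrow> W s = W1_integral k s)" for W
    by (simp add: W1_converges_minus)
  thus ?thesis by (simp add: W1_def)
qed

section \<open>Uniqueness of the continuation and its form as a quotient\<close>

lemma remove_sings_nicely_meromorphic_eq:
  assumes "f nicely_meromorphic_on A" "z \<in> A"
  shows "remove_sings f z = f z"
  using assms by (auto simp: nicely_meromorphic_on_def)

text \<open>The identity theorem applies to the difference with its singularities removed. Equality
  extends to poles because a nicely meromorphic function is determined at each point by its values
  nearby.\<close>

lemma nicely_meromorphic_on_eqI:
  assumes f: "f nicely_meromorphic_on A" and g: "g nicely_meromorphic_on A"
    and A: "open A" "connected A" and z: "z \<in> A" "frequently (\<lambda>z. f z = g z) (at z)" and w: "w \<in> A"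
  shows "f w = g w"
proof -
  define h where "h = (\<lambda>z. f z - g z)"
  have h: "h meromorphic_on A"
    using f g unfolding h_def nicely_meromorphic_on_def by (intro meromorphic_intros) auto
  have sing: "isolated_singularity_at h x" if "x \<in> A" for x
    using meromorphic_on_isolated_singularity[OF meromorphic_on_subset[OF h]] that by simp
  have "frequently (\<lambda>z. remove_sings h z = 0) (at z)"
    using frequently_eventually_frequently[OF z(2) eventually_remove_sings_eq_at[OF sing[OF z(1)]]]
    by (rule frequently_elim1) (auto simp: h_def)
  from frequently_eq_meromorphic_imp_constant[OF this remove_sings_nicely_meromorphic[OF h] A z(1)]
  have R: "remove_sings h x = 0" if "x \<in> A" for x using that by blast
  have "eventually (\<lambda>x. h x = 0) (at w)"
    using eventually_remove_sings_eq_at[OF sing[OF w]] eventually_at_in_open'[OF A(1) w]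
    by eventually_elim (use R in auto)
  hence "eventually (\<lambda>x. f x = g x) (at w)" by eventually_elim (simp add: h_def)
  hence "remove_sings f w = remove_sings g w" by (intro remove_sings_cong) auto
  thus ?thesis using remove_sings_nicely_meromorphic_eq f g w by metis
qed

lemma W1_eqI:
  assumes W: "W nicely_meromorphic_on UNIV" "\<And>s. W1_converges k s \<Longrightarrow> W s = W1_integral k s"
  shows "W1 k = W"
  unfolding W1_def
proof (rule the_equality)
  show "W nicely_meromorphic_on UNIV \<and> (\<forall>s. W1_converges k s \<longrightarrow> W s = W1_integral k s)"
    using W by blast
next
  fix V assume V: "V nicely_meromorphic_on UNIV \<and> (\<forall>s. W1_converges k s \<longrightarrow> V s = W1_integral k s)"
  \<comment> \<open>The integral converges for \<open>Re s > 0\<close>, so two candidates agree near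
    1 and hence everywhere.\<close>
  have "open {s. Re s > 0}" by (rule open_halfspace_Re_gt)
  hence "eventually (\<lambda>s. s \<in> {s. Re s > 0}) (at 1)" by (rule eventually_at_in_open') simp
  hence "eventually (\<lambda>s. V s = W s) (at 1)"
  proof eventually_elim
    case (elim s)
    hence "W1_converges k s"
      unfolding W1_converges_iff by (intro rcos_powr_integrable_nonneg) auto
    thus ?case using V W by metis
  qed
  hence "frequently (\<lambda>s. V s = W s) (at 1)" by (intro eventually_frequently) auto
  thus "V = W"
    using nicely_meromorphic_on_eqI[of V UNIV W 1] V W(1) by (auto simp: fun_eq_iff)
qed

text \<open>If \<open>N z\<close> were nonzero, the quotient would have a nonzero value at
  \<open>z\<close> or, where \<open>D z = 0\<close>, a pole. The point \<open>z0\<close> shows that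
  \<open>D\<close> is not identically 0, so its zeros are isolated.\<close>

lemma remove_sings_divide_eq_0_imp:
  assumes N: "N holomorphic_on UNIV" and D: "D holomorphic_on UNIV"
    and D_nz: "D z0 \<noteq> 0" and z: "\<not> is_pole (remove_sings (\<lambda>s. N s / D s)) z" "remove_sings (\<lambda>s. N s / D s) z = 0"
  shows "N z = 0"
proof (rule ccontr)
  assume "N z \<noteq> 0"
  have N': "N analytic_on A" and D': "D analytic_on A" for A
    using N D by (meson analytic_on_subset analytic_on_open open_UNIV subset_UNIV)+
  show False
  proof (cases "D z = 0")
    case False
    hence "(\<lambda>s. N s / D s) analytic_on {z}" by (intro analytic_intros N' D') auto
    hence "remove_sings (\<lambda>s. N s / D s) z = N z / D z" by simp
    thus False using z(2) \<open>N z \<noteq> 0\<close> False by simp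
  next
    case True
    have D_ne: "eventually (\<lambda>s. D s \<noteq> 0) (at z)"
      using non_zero_neighbour_alt[OF D open_UNIV connected_UNIV, of z z0] D_nz by simp
    have "isCont N z" "isCont D z" using N' D' by (auto intro: analytic_at_imp_isCont)
    hence "is_pole (\<lambda>s. N s / D s) z"
      using \<open>N z \<noteq> 0\<close> True D_ne by (intro is_pole_divide) (auto simp: filterlim_at isCont_def)
    moreover have "(\<lambda>s. N s / D s) meromorphic_on {z}"
      by (intro meromorphic_intros analytic_on_imp_meromorphic_on N' D')
    hence "isolated_singularity_at (\<lambda>s. N s / D s) z"
      by (rule meromorphic_on_isolated_singularity)
    ultimately show False using z(1) by simp
  qed
qed

text \<open>The quotient with its singularities removed is \<open>W1 k\<close>: it is meromorphic on
  the plane, and wherever the integral converges the denominator is nonzero and the quotient equals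
  the integral.\<close>

lemma W1_zero_imp_numerator_zero:
  assumes N: "N holomorphic_on UNIV" and D: "D holomorphic_on UNIV"
    and D_nz: "\<And>s. Re s > c \<Longrightarrow> D s \<noteq> 0"
    and conv: "\<And>s. W1_converges k s \<Longrightarrow> Re s > c"
    and eq: "\<And>s. Re s > c \<Longrightarrow> rcos_moment k s / of_real pi = N s / D s"
    and z: "z \<in> W1_zeros k"
  shows "N z = 0"
proof -
  have N': "N analytic_on A" and D': "D analytic_on A" for A
    using N D by (meson analytic_on_subset analytic_on_open open_UNIV subset_UNIV)+
  have "W1 k = remove_sings (\<lambda>s. N s / D s)"
  proof (rule W1_eqI)
    show "remove_sings (\<lambda>s. N s / D s) nicely_meromorphic_on UNIV"
      by (intro remove_sings_nicely_meromorphic meromorphic_intros analytic_on_imp_meromorphic_on N' D')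
    fix s assume s: "W1_converges k s"
    hence "(\<lambda>s. N s / D s) analytic_on {s}"
      using D_nz conv by (intro analytic_intros N' D') auto
    thus "remove_sings (\<lambda>s. N s / D s) s = W1_integral k s"
      using s eq conv by (simp add: W1_integral_eq)
  qed
  thus ?thesis using z D_nz[of "of_real (c + 1)"] remove_sings_divide_eq_0_imp[OF N D, of "of_real (c + 1)" z]
    by (auto simp: W1_zeros_def)
qed

text \<open>For \<open>s = x + i y\<close> the imaginary part of \<open>s * (s + 1)\<close> is
  \<open>(2 x + 1) y\<close> and the real part is \<open>x (x + 1) - y y\<close>.\<close>

lemma spectral_parameter_cases:
  fixes s :: complex
  assumes "Im (s * (s + 1)) = 0" "Re (s * (s + 1)) \<le> 0"
  shows "Re s = - 1 / 2 \<or> (\<exists>x\<in>{-1..0}. s = of_real x)"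
proof -
  obtain x y where s: "s = Complex x y" by (cases s)
  have "(2 * x + 1) * y = 0" "x * (x + 1) - y * y \<le> 0"
    using assms by (simp_all add: s algebra_simps)
  moreover have "x \<in> {-1..0}" if "x * (x + 1) \<le> 0" using that by (auto simp: mult_le_0_iff)
  ultimately show ?thesis by (auto simp: s complex_eq_iff)
qed

text \<open>The integrand is nonnegative, and continuous and positive on some subinterval.\<close>

lemma rcos_moment_real_nonzero:
  assumes "(\<lambda>t. rcos k t powr x) integrable_on {0..pi}"
  shows "rcos_moment k (of_real x) \<noteq> 0"
proof
  assume "rcos_moment k (of_real x) = 0"
  define I where "I = integral {0..pi} (\<lambda>t. rcos k t powr x)"
  have I: "((\<lambda>t. rcos k t powr x) has_integral I) {0..pi}"
    unfolding I_def using assms by (rule integrable_integral)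
  have "((\<lambda>t. complex_of_real (rcos k t powr x)) has_integral of_real I) {0..pi}"
    by (rule has_integral_of_real[OF I])
  hence "rcos_moment k (of_real x) = of_real I"
    unfolding rcos_moment_def
    by (intro integral_unique) (simp add: powr_of_real rcos_nonneg)
  hence "I = 0" using \<open>rcos_moment k (of_real x) = 0\<close> by simp
  \<comment> \<open>The only possible zero in \<open>{0..pi}\<close> is
    \<open>arccos (- k / 2)\<close>, so an interval of length \<open>pi / 4\<close> is placed at the
    opposite end.\<close>
  define a where "a = (if arccos (- k / 2) \<ge> pi / 2 then 0 else 3 * pi / 4)"
  define b where "b = a + pi / 4"
  have ab: "0 \<le> a" "a < b" "b \<le> pi" by (auto simp: a_def b_def field_simps)
  have nz: "rcos k t \<noteq> 0" if "t \<in> {a..b}" for t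
  proof
    assume "rcos k t = 0"
    hence "cos t = - k / 2" by (auto simp: rcos_def)
    hence eq: "arccos (- k / 2) = t" using that ab arccos_cos[of t] by auto
    have t: "a \<le> t" "t \<le> b" using that by auto
    show False
    proof (cases "t \<ge> pi / 2")
      case True
      hence "t \<le> pi / 4" using t eq by (simp add: a_def b_def)
      thus False using True pi_gt_zero by argo
    next
      case False
      hence "3 * pi / 4 \<le> t" using t eq by (simp add: a_def)
      thus False using False pi_gt_zero by argo
    qed
  qed
  have int_ab: "(\<lambda>t. rcos k t powr x) integrable_on {a..b}"
    using assms by (rule integrable_subinterval_real) (use ab in auto)
  have "integral {a..b} (\<lambda>t. rcos k t powr x) \<le> I"
    unfolding I_def by (intro integral_subset_le int_ab assms) (use ab in auto)
  moreover have "integral {a..b} (\<lambda>t. rcos k t powr x) \<ge> 0"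
    by (intro integral_nonneg int_ab) auto
  ultimately have "((\<lambda>t. rcos k t powr x) has_integral 0) {a..b}"
    using integrable_integral[OF int_ab] \<open>I = 0\<close> by simp
  moreover have "continuous_on {a..b} (\<lambda>t. rcos k t powr x)"
    by (intro continuous_on_powr continuous_rcos continuous_on_const) (use nz in auto)
  ultimately have "rcos k a powr x = 0"
    using has_integral_0_cbox_imp_0[of a b "\<lambda>t. rcos k t powr x" a] ab by simp
  thus False using nz[of a] ab by simp
qed

section \<open>The integral as a solution of the differential equation\<close>

text \<open>The weighted Wronskian is constant and vanishes at 0, so the quotient
  \<open>p / e\<close> has derivative 0.\<close>

lemma sturm_liouville_unique:
  fixes p p' e e' :: "real \<Rightarrow> complex" and w :: "real \<Rightarrow> real" and lam :: complex
  assumes "R \<ge> 0"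
    and p: "\<And>x. x \<in> {0..R} \<Longrightarrow> (p has_vector_derivative p' x) (at x within {0..R})"
    and p': "\<And>x. x \<in> {0..R} \<Longrightarrow>
      ((\<lambda>x. of_real (w x) * p' x) has_vector_derivative lam * of_real (w x) * p x) (at x within {0..R})"
    and e: "\<And>x. x \<in> {0..R} \<Longrightarrow> (e has_vector_derivative e' x) (at x within {0..R})"
    and e': "\<And>x. x \<in> {0..R} \<Longrightarrow>
      ((\<lambda>x. of_real (w x) * e' x) has_vector_derivative lam * of_real (w x) * e x) (at x within {0..R})"
    and w: "\<And>x. x \<in> {0..R} \<Longrightarrow> w x \<noteq> 0"
    and e_nz: "\<And>x. x \<in> {0..R} \<Longrightarrow> e x \<noteq> 0"
    and init: "p' 0 = 0" "e' 0 = 0"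
  shows "p R * e 0 = p 0 * e R"
proof -
  have R: "0 \<in> {0..R}" "R \<in> {0..R}" using \<open>R \<ge> 0\<close> by auto
  define wronskian where "wronskian = (\<lambda>x. (of_real (w x) * p' x) * e x - p x * (of_real (w x) * e' x))"
  have "(wronskian has_vector_derivative 0) (at x within {0..R})" if x: "x \<in> {0..R}" for x
  proof -
    note deriv = has_vector_derivative_diff[OF
        has_vector_derivative_mult[OF p'[OF x] e[OF x]] has_vector_derivative_mult[OF p[OF x] e'[OF x]]]
    show ?thesis
      unfolding wronskian_def by (rule has_vector_derivative_eq_rhs[OF deriv]) (simp add: algebra_simps)
  qed
  then obtain c where "\<And>x. x \<in> {0..R} \<Longrightarrow> wronskian x = c"
    using has_vector_derivative_zero_constant[of "{0..R}" wronskian] by auto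
  hence "wronskian x = 0" if "x \<in> {0..R}" for x
    using that R(1) by (metis init wronskian_def diff_self mult_zero_left mult_zero_right)
  hence *: "p' x * e x = p x * e' x" if "x \<in> {0..R}" for x
    using that w[OF that] by (auto simp: wronskian_def)
  have "((\<lambda>x. p x * inverse (e x)) has_vector_derivative 0) (at x within {0..R})" if x: "x \<in> {0..R}" for x
  proof -
    have "((inverse \<circ> e) has_vector_derivative e' x * - (inverse (e x) ^ Suc (Suc 0))) (at x within {0..R})"
      using DERIV_inverse[OF e_nz[OF x]] by (intro field_vector_diff_chain_within e x)
        (auto intro: has_field_derivative_at_within)
    hence **: "((\<lambda>x. inverse (e x)) has_vector_derivative e' x * - (inverse (e x) ^ Suc (Suc 0))) (at x within {0..R})"
      by (simp add: o_def)
    show ?thesis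
    proof (rule has_vector_derivative_eq_rhs[OF has_vector_derivative_mult[OF p[OF x] **]])
      have "(p x * (e' x * - (inverse (e x) ^ Suc (Suc 0))) + p' x * inverse (e x)) * (e x * e x) =
              p' x * e x - p x * e' x"
        using e_nz[OF x] by (simp add: field_simps)
      also have "\<dots> = 0" using *[OF x] by simp
      finally show "p x * (e' x * - (inverse (e x) ^ Suc (Suc 0))) + p' x * inverse (e x) = 0"
        using e_nz[OF x] by simp
    qed
  qed
  then obtain c where c: "\<And>x. x \<in> {0..R} \<Longrightarrow> p x * inverse (e x) = c"
    using has_vector_derivative_zero_constant[of "{0..R}" "\<lambda>x. p x * inverse (e x)"] by auto
  have "p R * inverse (e R) = p 0 * inverse (e 0)" using c R by simp
  thus ?thesis using e_nz R by (simp add: field_simps)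
qed

text \<open>Away from 0 this is the power rule; at 0 the difference quotient has modulus
  \<open>\<bar>h\<bar> powr (a - 1)\<close>, which tends to 0 since \<open>a > 1\<close>.\<close>

lemma has_real_derivative_abs_powr:
  fixes a y :: real
  assumes "a > 1"
  shows "((\<lambda>y. \<bar>y\<bar> powr a) has_real_derivative a * (y * \<bar>y\<bar> powr (a - 2))) (at y)"
proof -
  have powr_split: "z powr (a - 1) = z * z powr (a - 2)" if "z > 0" for z :: real
    using powr_add[of z 1 "a - 2"] that by simp
  consider "y > 0" | "y < 0" | "y = 0" by linarith
  thus ?thesis
  proof cases
    case 1
    have deriv: "((\<lambda>y. y powr a) has_real_derivative a * y powr (a - 1)) (at y)"
      using 1 by (rule has_real_derivative_powr)
    have ev: "eventually (\<lambda>z. z powr a = \<bar>z\<bar> powr a) (nhds y)"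
      using eventually_nhds_in_open[of "{0<..}" y] 1
      by (auto elim!: eventually_mono)
    have "((\<lambda>y. \<bar>y\<bar> powr a) has_real_derivative a * y powr (a - 1)) (at y)"
      using deriv DERIV_cong_ev[OF refl ev refl] by simp
    thus ?thesis using 1 by (simp add: powr_split)
  next
    case 2
    have deriv: "((\<lambda>y. (- y) powr a) has_real_derivative a * (- y) powr (a - 1) * (- 1)) (at y)"
      using 2 by (intro DERIV_chain2[OF has_real_derivative_powr]) (auto intro!: derivative_eq_intros)
    have ev: "eventually (\<lambda>z. (- z) powr a = \<bar>z\<bar> powr a) (nhds y)"
      using eventually_nhds_in_open[of "{..<0}" y] 2
      by (auto elim!: eventually_mono)
    have "((\<lambda>y. \<bar>y\<bar> powr a) has_real_derivative a * (- y) powr (a - 1) * (- 1)) (at y)"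
      using deriv DERIV_cong_ev[OF refl ev refl] by simp
    thus ?thesis using 2 by (simp add: powr_split)
  next
    case 3
    have "((\<lambda>h. \<bar>h\<bar> powr (a - 1)) \<longlongrightarrow> 0) (at 0)"
      using assms by (intro tendsto_zero_powrI tendsto_rabs_zero tendsto_ident_at tendsto_const) auto
    moreover have "\<bar>h\<bar> powr (a - 1) = norm (\<bar>h\<bar> powr a / h)" if "h \<noteq> 0" for h
      using that by (simp add: powr_diff)
    hence "eventually (\<lambda>h. \<bar>h\<bar> powr (a - 1) = norm (\<bar>h\<bar> powr a / h)) (at 0)"
      by (auto simp: eventually_at_filter)
    ultimately have "((\<lambda>h. norm (\<bar>h\<bar> powr a / h)) \<longlongrightarrow> 0) (at 0)"
      by (rule Lim_transform_eventually)
    hence "((\<lambda>h. \<bar>h\<bar> powr a / h) \<longlongrightarrow> 0) (at 0)" by (rule tendsto_norm_zero_cancel)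
    thus ?thesis using 3 by (simp add: has_field_derivative_iff)
  qed
qed

lemma sq_mult_abs_powr: "y * (y * \<bar>y\<bar> powr (a - 2)) = \<bar>y\<bar> powr (a::real)"
proof (cases "y = 0")
  case False
  have "\<bar>y\<bar> powr a = \<bar>y\<bar> powr 2 * \<bar>y\<bar> powr (a - 2)"
    unfolding powr_add[symmetric] by simp
  also have "\<bar>y\<bar> powr 2 = y * y" using False by (simp add: power2_eq_square)
  finally show ?thesis by simp
qed auto

text \<open>The product rule differentiates a power with exponent \<open>a - 2\<close>, which must
  exceed 1; hence \<open>a > 3\<close>.\<close>

lemma has_real_derivative_mult_abs_powr:
  fixes a y :: real
  assumes "a > 3"
  shows "((\<lambda>y. y * \<bar>y\<bar> powr (a - 2)) has_real_derivative (a - 1) * \<bar>y\<bar> powr (a - 2)) (at y)"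
proof (rule DERIV_cong[OF DERIV_mult[OF DERIV_ident has_real_derivative_abs_powr]])
  show "1 * \<bar>y\<bar> powr (a - 2) + (a - 2) * (y * \<bar>y\<bar> powr (a - 2 - 2)) * y = (a - 1) * \<bar>y\<bar> powr (a - 2)"
    using sq_mult_abs_powr[of y "a - 2"] by (simp add: algebra_simps)
qed (use assms in simp)

text \<open>For real \<open>a > 3\<close> the signed powers are smooth enough for
  \<open>mean_power_ode\<close> across 0, and \<open>a * (a + 1)\<close> is positive, so that
  \<open>even_sol\<close> has no zeros and \<open>sturm_liouville_unique\<close> applies. The
  initial value is the Beta integral.\<close>

lemma integral_abs_sinh_cosh_powr:
  assumes "a > 3" "\<eta> \<ge> 0"
  shows "integral {0..pi} (\<lambda>t. complex_of_real (\<bar>sinh \<eta> + cosh \<eta> * cos t\<bar> powr a)) =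
           of_real (Beta ((a + 1) / 2) (1 / 2)) * even_sol (of_real (a * (a + 1))) \<eta>"
proof -
  define \<psi> where "\<psi> = (\<lambda>y. complex_of_real (\<bar>y\<bar> powr a))"
  define \<psi>' where "\<psi>' = (\<lambda>y. complex_of_real (y * \<bar>y\<bar> powr (a - 2)))"
  define \<psi>'' where "\<psi>'' = (\<lambda>y. complex_of_real (\<bar>y\<bar> powr (a - 2)))"
  have \<psi>: "(\<psi> has_vector_derivative of_real a * \<psi>' y) (at y)" for y
    using has_vector_derivative_of_real[OF has_real_derivative_abs_powr[of a y]] assms
    by (simp add: \<psi>_def \<psi>'_def)
  have \<psi>': "(\<psi>' has_vector_derivative (of_real a - 1) * \<psi>'' y) (at y)" for y
    using has_vector_derivative_of_real[OF has_real_derivative_mult_abs_powr[of a y]] assms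
    by (simp add: \<psi>'_def \<psi>''_def)
  have \<psi>'': "continuous_on A \<psi>''" for A
    unfolding \<psi>''_def using assms by (intro continuous_intros continuous_on_powr') auto
  have \<psi>'_cont: "continuous_on UNIV \<psi>'"
    by (rule continuous_on_vector_derivative[OF has_vector_derivative_at_within]) (rule \<psi>')
  have mult: "of_real y * \<psi>'' y = \<psi>' y" "of_real y * \<psi>' y = \<psi> y" for y
    by (simp_all add: \<psi>_def \<psi>'_def \<psi>''_def flip: of_real_mult sq_mult_abs_powr[of _ a])
  define g where "g = (\<lambda>x. integral {0..pi} (\<lambda>t. \<psi> (sinh x + cosh x * cos t)))"
  define g' where "g' = (\<lambda>x. of_real a * integral {0..pi} (\<lambda>t.
     of_real (cosh x + sinh x * cos t) * \<psi>' (sinh x + cosh x * cos t)))"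
  have sinh: "(sinh has_real_derivative cosh x) (at x)" and cosh: "(cosh has_real_derivative sinh x) (at x)"
    for x :: real
    by (auto intro!: derivative_eq_intros)
  have sc: "(cosh x)\<^sup>2 - (sinh x)\<^sup>2 = 1" for x :: real by (rule hyperbolic_pythagoras)
  note ode = mean_power_ode[where S = sinh and C = cosh and U = "{0..\<eta>}" and D = UNIV and s = "of_real a"
      and \<psi> = \<psi> and \<psi>' = \<psi>' and \<psi>'' = \<psi>'', OF _ _ sinh cosh sc UNIV_I \<psi> \<psi>' \<psi>'' mult, folded g_def g'_def]
  define lam where "lam = complex_of_real (a * (a + 1))"
  have lam: "lam = of_real a * (of_real a + 1)" by (simp add: lam_def)
  have "g \<eta> * even_sol lam 0 = g 0 * even_sol lam \<eta>"
  proof (rule sturm_liouville_unique[where w = cosh and p' = g' and e' = "even_sol_deriv lam" and lam = lam])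
    show "\<eta> \<ge> 0" by fact
    fix x assume x: "x \<in> {0..\<eta>}"
    show "(g has_vector_derivative g' x) (at x within {0..\<eta>})"
      using ode(1)[of x] x by (simp add: g'_def)
    show "((\<lambda>x. of_real (cosh x) * g' x) has_vector_derivative lam * of_real (cosh x) * g x) (at x within {0..\<eta>})"
      using ode(2)[of x] x by (simp add: g_def g'_def lam)
    show "(even_sol lam has_vector_derivative even_sol_deriv lam x) (at x within {0..\<eta>})"
      using x by (rule even_sol_has_derivative)
    show "((\<lambda>x. of_real (cosh x) * even_sol_deriv lam x) has_vector_derivative
             lam * of_real (cosh x) * even_sol lam x) (at x within {0..\<eta>})"
      using x by (rule even_sol_ode)
    show "even_sol lam x \<noteq> 0"
      unfolding lam_def using x assms by (intro even_sol_nonneg_nz) auto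
  next
    \<comment> \<open>At 0 the slope is a multiple of the integral of
      \<open>\<psi>' (cos t)\<close>, which is odd about \<open>pi / 2\<close>.\<close>
    have J: "((\<lambda>t. \<psi>' (cos t)) has_integral integral {0..pi} (\<lambda>t. \<psi>' (cos t))) {0..pi}"
      by (intro integrable_integral integrable_continuous_interval continuous_on_compose2[OF
            \<psi>'_cont]) (auto intro!: continuous_intros)
    have "\<psi>' (- y) = - \<psi>' y" for y by (simp add: \<psi>'_def)
    with has_integral_reflect_about[OF J, of pi]
    have "((\<lambda>t. - \<psi>' (cos t)) has_integral integral {0..pi} (\<lambda>t. \<psi>' (cos t))) {0..pi}" by simp
    from has_integral_unique[OF has_integral_neg[OF J] this]
    show "g' 0 = 0" by (simp add: g'_def)
  qed (simp_all add: even_sol_deriv_0)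
  moreover have "g 0 = of_real (Beta ((a + 1) / 2) (1 / 2))"
  proof -
    have "((\<lambda>t. \<bar>cos t\<bar> powr a) has_integral Beta ((a + 1) / 2) (1 / 2)) {0..pi}"
      using assms by (intro abs_cos_powr_has_integral) auto
    hence "((\<lambda>t. complex_of_real (\<bar>cos t\<bar> powr a)) has_integral of_real (Beta ((a + 1) / 2) (1 / 2))) {0..pi}"
      by (rule has_integral_of_real)
    thus ?thesis
      by (simp add: g_def \<psi>_def integral_unique)
  qed
  ultimately show ?thesis
    by (simp add: g_def \<psi>_def even_sol_0 lam_def)
qed

section \<open>Zeros\<close>

lemma tanh_surj_unit:
  assumes "0 \<le> x" "x < (1::real)"
  obtains y where "y \<ge> 0" "tanh y = x"
proof
  define y where "y = ln ((1 + x) / (1 - x)) / 2"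
  show "y \<ge> 0" using assms by (simp add: y_def)
  have "exp (- 2 * y) = inverse ((1 + x) / (1 - x))"
    using assms by (simp add: y_def exp_minus)
  hence E: "exp (- 2 * y) = (1 - x) / (1 + x)" by simp
  have "1 + x \<noteq> 0" using assms by simp
  thus "tanh y = x" unfolding tanh_real_altdef E by (simp add: field_simps)
qed

lemma rcos_tanh:
  "rcos (2 * tanh \<eta>) t = 2 / cosh \<eta> * \<bar>sinh \<eta> + cosh \<eta> * cos t\<bar>"
proof -
  have "2 * tanh \<eta> + 2 * cos t = 2 / cosh \<eta> * (sinh \<eta> + cosh \<eta> * cos t)"
    by (simp add: tanh_def field_simps)
  moreover have "\<bar>2 / cosh \<eta>\<bar> = 2 / cosh \<eta>" by simp
  ultimately show ?thesis by (simp only: rcos_def abs_mult)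
qed

lemma rcos_coth:
  assumes "\<eta> > 0"
  shows "rcos (2 / tanh \<eta>) t = 2 / sinh \<eta> * \<bar>cosh \<eta> + sinh \<eta> * cos t\<bar>"
proof -
  have "2 / tanh \<eta> + 2 * cos t = 2 / sinh \<eta> * (cosh \<eta> + sinh \<eta> * cos t)"
    using assms by (simp add: tanh_def field_simps)
  moreover have "\<bar>2 / sinh \<eta>\<bar> = 2 / sinh \<eta>" using assms by simp
  ultimately show ?thesis by (simp only: rcos_def abs_mult)
qed

section \<open>The case |k| < 2\<close>

lemma rcos_moment_holomorphic:
  assumes "\<bar>k\<bar> < 2"
  shows "rcos_moment k holomorphic_on {s. Re s > - 1}"
  unfolding rcos_moment_def[abs_def] using rcos_powr_integrable_iff[OF assms]
  by (intro integral_powr_holomorphic continuous_rcos rcos_nonneg) auto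

text \<open>The Beta factor \<open>Beta ((s + 1) / 2) (1 / 2)\<close> is split: its gamma factor
  with poles goes to the denominator as \<open>rGamma ((s + 1) / 2)\<close>, which leaves an entire
  numerator. Here \<open>rGamma (s / 2 + 1)\<close> carries the trivial zeros.\<close>

definition tanh_numerator :: "real \<Rightarrow> complex \<Rightarrow> complex" where
  "tanh_numerator \<eta> s = of_real (2 / cosh \<eta>) powr s * of_real (sqrt pi) * rGamma (s / 2 + 1) *
     even_sol (s * (s + 1)) \<eta>"

lemma tanh_numerator_holomorphic:
  assumes "\<eta> \<ge> 0"
  shows "tanh_numerator \<eta> holomorphic_on A"
proof -
  have "(\<lambda>s. s * (s + 1)) holomorphic_on A" by (intro holomorphic_intros)
  from holomorphic_on_compose_gen[OF this even_sol_holomorphic[OF assms, of UNIV]]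
  have "(\<lambda>s. even_sol (s * (s + 1)) \<eta>) holomorphic_on A" by (simp add: o_def)
  thus ?thesis unfolding tanh_numerator_def[abs_def] by (intro holomorphic_intros) auto
qed

lemma rGamma_half_nonzero: "Re s > - 1 \<Longrightarrow> rGamma ((s + 1) / 2 :: complex) \<noteq> 0"
  by (auto simp: rGamma_eq_zero_iff elim!: nonpos_Ints_cases dest!: arg_cong[of _ _ Re])

text \<open>Both sides are holomorphic for \<open>Re s > - 1\<close> and agree for real
  \<open>s > 3\<close>, a set that accumulates at 4; the identity theorem does the rest.\<close>

lemma rcos_moment_tanh:
  assumes \<eta>: "\<eta> \<ge> 0" and s: "Re s > - 1"
  shows "rcos_moment (2 * tanh \<eta>) s = tanh_numerator \<eta> s / rGamma ((s + 1) / 2)"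
proof -
  let ?k = "2 * tanh \<eta>"
  define H where "H = (\<lambda>s. rcos_moment ?k s - tanh_numerator \<eta> s / rGamma ((s + 1) / 2))"
  have k: "\<bar>?k\<bar> < 2" using tanh_real_bounds[of \<eta>] by (auto simp: abs_less_iff)
  have "H s = 0"
  proof (rule analytic_continuation[of H "{s. Re s > - 1}" "of_real ` {3<..}" "of_real 4"])
    show "H holomorphic_on {s. Re s > - 1}"
      unfolding H_def using k \<eta>
      by (intro holomorphic_intros rcos_moment_holomorphic tanh_numerator_holomorphic)
         (auto dest: rGamma_half_nonzero)
    show "open {s. Re s > - 1}" by (rule open_halfspace_Re_gt)
    show "connected {s. Re s > - 1}" by (intro convex_connected convex_halfspace_Re_gt)
    show "complex_of_real 4 islimpt of_real ` {3<..}"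
      unfolding islimpt_approachable
    proof (intro allI impI)
      fix e :: real assume "e > 0"
      hence "dist (complex_of_real (4 + e / 2)) (of_real 4) < e"
        "complex_of_real (4 + e / 2) \<noteq> of_real 4"
        unfolding dist_of_real of_real_eq_iff by (simp_all add: dist_real_def)
      moreover have "complex_of_real (4 + e / 2) \<in> of_real ` {3<..}" using \<open>e > 0\<close> by (intro imageI) simp
      ultimately show "\<exists>x'\<in>complex_of_real ` {3<..}. x' \<noteq> of_real 4 \<and> dist x' (of_real 4) < e"
        by blast
    qed
    show "H z = 0" if z: "z \<in> of_real ` {3<..}" for z
    proof -
      obtain a :: real where a: "a > 3" "z = of_real a" using z by auto
      let ?c = "2 / cosh \<eta>"
      have "complex_of_real (rcos ?k t) powr z = of_real (?c powr a) * of_real (\<bar>sinh \<eta> + cosh \<eta> * cos t\<bar> powr a)" for t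
      proof -
        have "rcos ?k t powr a = ?c powr a * \<bar>sinh \<eta> + cosh \<eta> * cos t\<bar> powr a"
          unfolding rcos_tanh by (subst powr_mult) auto
        thus ?thesis using a(2) rcos_nonneg by (simp only: powr_of_real of_real_mult)
      qed
      hence "rcos_moment ?k z = integral {0..pi} (\<lambda>t. of_real (?c powr a) *
              of_real (\<bar>sinh \<eta> + cosh \<eta> * cos t\<bar> powr a))"
        by (simp only: rcos_moment_def)
      also have "\<dots> = of_real (?c powr a) * (of_real (Beta ((a + 1) / 2) (1 / 2)) *
              even_sol (of_real (a * (a + 1))) \<eta>)"
        using a \<eta> by (simp only: integral_mult_right integral_abs_sinh_cosh_powr)
      also have "Beta ((a + 1) / 2) (1 / 2) = Gamma ((a + 1) / 2) * sqrt pi * rGamma (a / 2 + 1)"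
      proof -
        have eq: "(a + 1) / 2 + 1 / 2 = a / 2 + 1" by (simp add: field_simps)
        show ?thesis unfolding Beta_def eq Gamma_one_half_real rGamma_inverse_Gamma by (rule divide_inverse)
      qed
      also have "complex_of_real (Gamma ((a + 1) / 2) * sqrt pi * rGamma (a / 2 + 1)) =
          Gamma ((z + 1) / 2) * of_real (sqrt pi) * rGamma (z / 2 + 1)"
        by (simp add: a flip: Gamma_complex_of_real rGamma_complex_of_real)
      also have "of_real (?c powr a) = of_real ?c powr z"
        unfolding a(2) by (rule powr_of_real[symmetric]) simp
      also have "complex_of_real (a * (a + 1)) = z * (z + 1)" by (simp add: a)
      finally have "rcos_moment ?k z = tanh_numerator \<eta> z * Gamma ((z + 1) / 2)"
        by (simp add: tanh_numerator_def mult_ac)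
      thus ?thesis
        unfolding H_def rGamma_inverse_Gamma
        by (simp only: divide_inverse[of _ "inverse _"] inverse_inverse_eq diff_self)
    qed
  qed (use s in auto)
  thus ?thesis by (simp add: H_def)
qed

lemma rGamma_zero_imp:
  assumes "rGamma (z + 1 :: complex) = 0"
  obtains n :: nat where "n \<ge> 1" "z = - of_nat n"
proof -
  from assms obtain m :: int where m: "m \<le> 0" "z + 1 = of_int m"
    unfolding rGamma_eq_zero_iff by (auto elim!: nonpos_Ints_cases)
  show thesis
  proof (rule that[of "nat (1 - m)"])
    have "z = of_int (m - 1)" using m(2) by (simp add: algebra_simps)
    thus "z = - of_nat (nat (1 - m))" using m(1) by simp
  qed (use m in simp)
qed

text \<open>Self-adjointness leaves only real \<open>s\<close> in \<open>{- 1..0}\<close> to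
  exclude, where a zero of \<open>even_sol\<close> would force a nonzero integral of a real power to
  vanish.\<close>

lemma even_sol_zero_critical:
  assumes \<eta>: "\<eta> \<ge> 0" and zero: "even_sol (s * (s + 1)) \<eta> = 0"
  shows "Re s = - 1 / 2"
proof (rule ccontr)
  assume "Re s \<noteq> - 1 / 2"
  then obtain x where x: "x \<in> {- 1..0}" "s = of_real x"
    using spectral_parameter_cases even_sol_zero_imp[OF \<eta> zero] by blast
  \<comment> \<open>At \<open>s = - 1\<close> the integral diverges, but \<open>s = 0\<close> has the same value of \<open>s * (s + 1)\<close>.\<close>
  define y where "y = (if x = - 1 then 0 else x)"
  have y: "y > - 1" using x by (auto simp: y_def)
  have "s * (s + 1) = of_real y * (of_real y + 1)" using x by (simp add: y_def)
  hence "tanh_numerator \<eta> (of_real y) = 0" using zero by (simp add: tanh_numerator_def)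
  hence "rcos_moment (2 * tanh \<eta>) (of_real y) = 0"
    using rcos_moment_tanh[OF \<eta>, of "of_real y"] y by simp
  moreover have "\<bar>2 * tanh \<eta>\<bar> < 2" using tanh_real_bounds[of \<eta>] by (auto simp: abs_less_iff)
  ultimately show False
    using rcos_moment_real_nonzero rcos_powr_integrable_iff y by blast
qed

lemma W1_zeros_small:
  assumes k: "0 \<le> k" "k < 2" and s: "s \<in> W1_nontrivial_zeros k"
  shows "Re s = - 1 / 2"
proof -
  obtain \<eta> where \<eta>: "\<eta> \<ge> 0" "tanh \<eta> = k / 2" using tanh_surj_unit[of "k / 2"] k by auto
  hence k_eq: "2 * tanh \<eta> = k" by simp
  have "tanh_numerator \<eta> s / of_real pi = 0"
  proof (rule W1_zero_imp_numerator_zero[where k = k and c = "- 1" and D = "\<lambda>s. rGamma ((s + 1) / 2)"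
        and N = "\<lambda>s. tanh_numerator \<eta> s / of_real pi"])
    show "s \<in> W1_zeros k" using s by (simp add: W1_nontrivial_zeros_def)
    show "Re s > - 1" if "W1_converges k s" for s
      using that rcos_powr_integrable_iff[of k "Re s"] k by (simp add: W1_converges_iff)
    show "rcos_moment k s / of_real pi = tanh_numerator \<eta> s / of_real pi / rGamma ((s + 1) / 2)"
      if "Re s > - 1" for s
      using rcos_moment_tanh[OF \<eta>(1) that] by (simp add: k_eq)
  qed (use \<eta> in \<open>auto intro!: holomorphic_intros tanh_numerator_holomorphic dest: rGamma_half_nonzero\<close>)
  \<comment> \<open>The other factors are a power of a positive constant and \<open>sqrt pi\<close>,
    which never vanish.\<close>
  hence "rGamma (s / 2 + 1) = 0 \<or> even_sol (s * (s + 1)) \<eta> = 0"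
    by (auto simp: tanh_numerator_def)
  thus ?thesis
  proof
    assume "rGamma (s / 2 + 1) = 0"
    then obtain n :: nat where n: "n \<ge> 1" "s / 2 = - of_nat n" by (rule rGamma_zero_imp)
    hence "s = - of_nat (2 * n)" by (simp add: field_simps)
    hence "s \<in> W1_trivial_zeros k" using n(1) k by (auto simp: W1_trivial_zeros_def)
    thus ?thesis using s by (simp add: W1_nontrivial_zeros_def)
  qed (use even_sol_zero_critical \<eta> in blast)
qed

section \<open>The case |k| = 2\<close>

lemma rcos_2: "rcos 2 (2 * t) = (rcos 0 t)\<^sup>2"
proof -
  have "2 + 2 * cos (2 * t) = (2 * cos t)\<^sup>2" by (simp add: cos_double_cos power2_eq_square)
  thus ?thesis by (simp add: rcos_def)
qed

text \<open>Halving the angle turns \<open>rcos 2\<close> into the square of \<open>rcos 0\<close>,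
  and the symmetry of \<open>rcos 0\<close> about \<open>pi / 2\<close> restores the full interval.
  Thus \<open>k = 2\<close> reduces to \<open>k = 0\<close> with doubled exponent.\<close>

lemma has_integral_rcos_2:
  fixes h :: "real \<Rightarrow> 'a :: banach"
  assumes "(\<lambda>t. h (rcos 0 t)) integrable_on {0..pi}"
  shows "((\<lambda>t. h (sqrt (rcos 2 t))) has_integral integral {0..pi} (\<lambda>t. h (rcos 0 t))) {0..pi}"
proof -
  have "(\<lambda>t. h (rcos 0 t)) integrable_on {0..pi / 2}"
    using assms by (rule integrable_subinterval_real) auto
  then obtain J where J: "((\<lambda>t. h (rcos 0 t)) has_integral J) {0..pi / 2}" by blast
  have "((\<lambda>t. h (rcos 0 t)) has_integral 2 *\<^sub>R J) {0..2 * (pi / 2)}"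
    by (rule has_integral_symmetric[OF _ J]) (auto simp: rcos_def)
  hence eq: "integral {0..pi} (\<lambda>t. h (rcos 0 t)) = 2 *\<^sub>R J" by (simp add: integral_unique)
  have "((\<lambda>t. h (rcos 0 (1/2 * t))) has_integral J /\<^sub>R (1/2)) {0..pi}"
    by (subst has_integral_stretch_01[of "1/2" "\<lambda>t. h (rcos 0 t)"]) (use J in auto)
  moreover have "sqrt (rcos 2 t) = rcos 0 (1/2 * t)" for t
    using rcos_2[of "t / 2"] rcos_nonneg[of 0 "t / 2"] by simp
  ultimately show ?thesis by (simp add: eq)
qed

lemma rcos_2_powr_integrable_iff: "(\<lambda>t. rcos 2 t powr \<sigma>) integrable_on {0..pi} \<longleftrightarrow> \<sigma> > - 1 / 2"
proof
  assume "\<sigma> > - 1 / 2"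
  hence "(\<lambda>t. rcos 0 t powr (2 * \<sigma>)) integrable_on {0..pi}"
    by (subst rcos_powr_integrable_iff) auto
  from has_integral_rcos_2[where h = "\<lambda>x. x powr (2 * \<sigma>)", OF this]
  have "(\<lambda>t. sqrt (rcos 2 t) powr (2 * \<sigma>)) integrable_on {0..pi}" by blast
  thus "(\<lambda>t. rcos 2 t powr \<sigma>) integrable_on {0..pi}"
    by (simp add: rcos_nonneg powr_powr flip: powr_half_sqrt)
next
  have eq: "rcos 2 (2 * t) powr \<sigma> = rcos 0 t powr (2 * \<sigma>)" for t
    using powr_powr[of "rcos 0 t" 2 \<sigma>] rcos_nonneg[of 0 t] by (cases "rcos 0 t = 0") (simp_all add: rcos_2)
  assume "(\<lambda>t. rcos 2 t powr \<sigma>) integrable_on {0..pi}"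
  then obtain I where "((\<lambda>t. rcos 2 t powr \<sigma>) has_integral I) {0..2 * (pi / 2)}" by auto
  hence "((\<lambda>t. rcos 2 (2 * t) powr \<sigma>) has_integral I /\<^sub>R 2) {0..pi / 2}"
    by (subst has_integral_stretch_01[of 2 "\<lambda>t. rcos 2 t powr \<sigma>"]) auto
  hence "((\<lambda>t. rcos 0 t powr (2 * \<sigma>)) has_integral I /\<^sub>R 2) {0..pi / 2}"
    by (simp only: eq)
  hence "((\<lambda>t. rcos 0 t powr (2 * \<sigma>)) has_integral 2 *\<^sub>R (I /\<^sub>R 2)) {0..2 * (pi / 2)}"
    by (intro has_integral_symmetric) (auto simp: rcos_def)
  hence "(\<lambda>t. rcos 0 t powr (2 * \<sigma>)) integrable_on {0..pi}" by auto
  thus "\<sigma> > - 1 / 2" by (subst (asm) rcos_powr_integrable_iff) auto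
qed

lemma rcos_moment_2:
  assumes "Re s > - 1 / 2"
  shows "rcos_moment 2 s = rcos_moment 0 (2 * s)"
proof -
  have "(\<lambda>t. rcos 0 t powr Re (2 * s)) integrable_on {0..pi}"
    using assms by (subst rcos_powr_integrable_iff) auto
  from rcos_moment_has_integral[OF this]
  have "(\<lambda>t. complex_of_real (rcos 0 t) powr (2 * s)) integrable_on {0..pi}" by blast
  from has_integral_rcos_2[where h = "\<lambda>x. complex_of_real x powr (2 * s)", OF this]
  have "integral {0..pi} (\<lambda>t. complex_of_real (sqrt (rcos 2 t)) powr (2 * s)) = rcos_moment 0 (2 * s)"
    by (simp add: rcos_moment_def integral_unique)
  moreover have "complex_of_real (sqrt x) powr (2 * s) = of_real x powr s" if "x \<ge> 0" for x
    using that by (cases "x = 0") (auto simp: of_real_powr_eq_exp ln_sqrt)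
  ultimately show ?thesis by (simp add: rcos_moment_def rcos_nonneg)
qed

lemma W1_zeros_2:
  assumes s: "s \<in> W1_nontrivial_zeros 2"
  shows "Re s = - 1 / 2"
proof -
  have "tanh_numerator 0 (2 * s) / of_real pi = 0"
  proof (rule W1_zero_imp_numerator_zero[where k = 2 and c = "- 1 / 2" and D = "\<lambda>s. rGamma ((2 * s + 1) / 2)"
        and N = "\<lambda>s. tanh_numerator 0 (2 * s) / of_real pi"])
    show "s \<in> W1_zeros 2" using s by (simp add: W1_nontrivial_zeros_def)
    show "Re s > - 1 / 2" if "W1_converges 2 s" for s
      using that rcos_2_powr_integrable_iff by (simp add: W1_converges_iff)
    show "rcos_moment 2 s / of_real pi = tanh_numerator 0 (2 * s) / of_real pi / rGamma ((2 * s + 1) / 2)"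
      if "Re s > - 1 / 2" for s
      using rcos_moment_tanh[of 0 "2 * s"] that by (simp add: rcos_moment_2)
    show "rGamma ((2 * s + 1) / 2) \<noteq> 0" if "Re s > - 1 / 2" for s :: complex
      using rGamma_half_nonzero[of "2 * s"] that by simp
    show "(\<lambda>s. tanh_numerator 0 (2 * s) / of_real pi) holomorphic_on UNIV"
      using holomorphic_on_compose_gen[OF _ tanh_numerator_holomorphic[of 0 UNIV], of "\<lambda>s. 2 * s" UNIV]
      by (auto simp: o_def intro!: holomorphic_intros)
  qed (auto intro!: holomorphic_intros)
  \<comment> \<open>At \<open>\<eta> = 0\<close> the factor \<open>even_sol\<close> equals 1, so
    only the reciprocal gamma factor can vanish.\<close>
  hence "rGamma (s + 1) = 0"
    by (simp add: tanh_numerator_def even_sol_0)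
  then obtain n :: nat where n: "n \<ge> 1" "s = - of_nat n" by (rule rGamma_zero_imp)
  hence "s \<in> W1_trivial_zeros 2" by (auto simp: W1_trivial_zeros_def)
  thus ?thesis using s by (simp add: W1_nontrivial_zeros_def)
qed

section \<open>The case |k| > 2\<close>

lemma cosh_sinh_cos_pos:
  assumes "x \<ge> (0::real)"
  shows "cosh x + sinh x * cos t > 0"
proof -
  have "sinh x * - cos t \<le> sinh x * 1" using assms by (intro mult_left_mono) (auto simp: minus_le_iff)
  also have "\<dots> < cosh x" using sinh_less_cosh_real[of x] by simp
  finally show ?thesis by simp
qed

text \<open>Up to the factor \<open>pi\<close> this is Laplace's integral for the Legendre function
  of degree \<open>s\<close> at \<open>cosh \<eta>\<close>. The weight is now \<open>sinh\<close>,
  whose zero at 0 supplies the boundary condition there; the integral itself is \<open>pi\<close> at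
  0.\<close>

lemma legendre_integral_zero_critical:
  assumes \<eta>: "\<eta> > 0"
    and zero: "integral {0..pi} (\<lambda>t. complex_of_real (cosh \<eta> + sinh \<eta> * cos t) powr s) = 0"
  shows "Im (s * (s + 1)) = 0" "Re (s * (s + 1)) \<le> 0"
proof -
  define g where "g = (\<lambda>x. integral {0..pi} (\<lambda>t. complex_of_real (cosh x + sinh x * cos t) powr s))"
  define g' where "g' = (\<lambda>x. s * integral {0..pi} (\<lambda>t.
     of_real (sinh x + cosh x * cos t) * complex_of_real (cosh x + sinh x * cos t) powr (s - 1)))"
  have powr_deriv: "((\<lambda>y. complex_of_real y powr a) has_vector_derivative a * complex_of_real y powr (a - 1)) (at y)"
    if "y \<in> {0<..}" for y a
    using that by (intro has_vector_derivative_real_field has_field_derivative_powr) (auto simp: complex_nonpos_Reals_iff)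
  have powr_deriv': "((\<lambda>y. complex_of_real y powr (s - 1)) has_vector_derivative (s - 1) * complex_of_real y powr (s - 2)) (at y)"
    if "y \<in> {0<..}" for y
    using powr_deriv[OF that, of "s - 1"] by (simp add: diff_diff_eq)
  have cont: "continuous_on {0<..} (\<lambda>y. complex_of_real y powr (s - 2))"
    by (rule continuous_on_vector_derivative[OF has_vector_derivative_at_within[OF powr_deriv]]) auto
  have mult: "of_real y * complex_of_real y powr (s - 2) = complex_of_real y powr (s - 1)"
    "of_real y * complex_of_real y powr (s - 1) = complex_of_real y powr s" if "y \<in> {0<..}" for y
    using powr_add[of "complex_of_real y" 1 "s - 2"] powr_add[of "complex_of_real y" 1 "s - 1"] that
    by (auto simp: algebra_simps)
  have sinh: "(sinh has_real_derivative cosh x) (at x)" and cosh: "(cosh has_real_derivative sinh x) (at x)"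
    for x :: real
    by (auto intro!: derivative_eq_intros)
  have sc: "(sinh x)\<^sup>2 - (cosh x)\<^sup>2 = - 1" for x :: real using hyperbolic_pythagoras[of x] by simp
  have dom: "cosh x + sinh x * cos t \<in> {0<..}" if "x \<in> {0..\<eta>}" for x t
    using cosh_sinh_cos_pos[of x t] that by simp
  note ode = mean_power_ode[where S = cosh and C = sinh and U = "{0..\<eta>}" and D = "{0<..}" and s = s,
      OF _ _ cosh sinh sc dom powr_deriv powr_deriv' cont mult]
  have "Im (s * (s + 1)) = 0 \<and> Re (s * (s + 1)) \<le> 0"
  proof (rule sturm_liouville_eigenvalue_nonpos[where R = \<eta> and p = g and p' = g' and w = sinh])
    fix x assume x: "x \<in> {0..\<eta>}"
    show "(g has_vector_derivative g' x) (at x within {0..\<eta>})"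
      unfolding g_def g'_def by (rule ode(1)) (use x in auto)
    show "((\<lambda>x. of_real (sinh x) * g' x) has_vector_derivative s * (s + 1) * of_real (sinh x) * g x)
            (at x within {0..\<eta>})"
      unfolding g_def g'_def by (rule ode(2)) (use x in auto)
  next
    show "continuous_on {0..\<eta>} g'"
      unfolding g'_def by (rule ode(3)[of 0]) (use \<eta> in auto)
  qed (use \<eta> zero in \<open>auto simp: g_def intro!: continuous_intros\<close>)
  thus "Im (s * (s + 1)) = 0" "Re (s * (s + 1)) \<le> 0" by auto
qed

lemma W1_zeros_large:
  assumes k: "k > 2" and s: "s \<in> W1_nontrivial_zeros k"
  shows "Re s = - 1 / 2"
proof (rule ccontr)
  assume not_crit: "Re s \<noteq> - 1 / 2"
  obtain \<eta> where \<eta>: "\<eta> \<ge> 0" "tanh \<eta> = 2 / k" using tanh_surj_unit[of "2 / k"] k by auto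
  hence "\<eta> \<noteq> 0" using k by auto
  with \<eta> have \<eta>_pos: "\<eta> > 0" by simp
  have k_eq: "k = 2 / tanh \<eta>" using \<eta> k by simp
  \<comment> \<open>For \<open>k > 2\<close> the function \<open>rcos k\<close> has no zeros, so the
    integral exists for every exponent and will define an entire function.\<close>
  have int: "(\<lambda>t. rcos k t powr \<sigma>) integrable_on {0..pi}" for \<sigma>
  proof (intro integrable_continuous_interval continuous_on_powr continuous_rcos continuous_on_const ballI)
    fix t
    show "rcos k t \<noteq> 0"
      using cosh_sinh_cos_pos[OF \<eta>(1), of t] \<eta>_pos by (simp add: k_eq rcos_coth)
  qed
  have "rcos_moment k holomorphic_on {s. Re s > c}" for c
    unfolding rcos_moment_def[abs_def] using int
    by (intro integral_powr_holomorphic continuous_rcos rcos_nonneg)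
  hence "rcos_moment k holomorphic_on (\<Union>c. {s. Re s > c})"
    by (intro holomorphic_on_UN_open open_halfspace_Re_gt)
  also have "(\<Union>c. {s. Re s > c}) = UNIV" by (auto intro: lt_ex)
  finally have "(\<lambda>s. rcos_moment k s / of_real pi) holomorphic_on UNIV" by (intro holomorphic_intros) auto
  hence "(\<lambda>s. rcos_moment k s / of_real pi) analytic_on UNIV" by (simp add: analytic_on_open)
  hence "(\<lambda>s. rcos_moment k s / of_real pi) nicely_meromorphic_on UNIV"
    by (rule analytic_on_imp_nicely_meromorphic_on)
  hence "W1 k = (\<lambda>s. rcos_moment k s / of_real pi)"
    by (rule W1_eqI) (simp add: W1_integral_eq)
  hence zero: "rcos_moment k s = 0"
    using s by (simp add: W1_nontrivial_zeros_def W1_zeros_def)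
  define c where "c = 2 / sinh \<eta>"
  have c: "c > 0" using \<eta>_pos by (simp add: c_def)
  have "complex_of_real (rcos k t) powr s = of_real c powr s * of_real (cosh \<eta> + sinh \<eta> * cos t) powr s" for t
  proof -
    have v: "cosh \<eta> + sinh \<eta> * cos t > 0" using \<eta>(1) by (rule cosh_sinh_cos_pos)
    hence "rcos k t = c * (cosh \<eta> + sinh \<eta> * cos t)" using \<eta>_pos by (simp add: k_eq rcos_coth c_def)
    thus ?thesis using v c powr_times_real[of "of_real c" "of_real (cosh \<eta> + sinh \<eta> * cos t)" s]
      by (simp only: of_real_mult) simp
  qed
  hence "rcos_moment k s = of_real c powr s *
      integral {0..pi} (\<lambda>t. complex_of_real (cosh \<eta> + sinh \<eta> * cos t) powr s)"
    by (simp only: rcos_moment_def integral_mult_right)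
  hence "integral {0..pi} (\<lambda>t. complex_of_real (cosh \<eta> + sinh \<eta> * cos t) powr s) = 0"
    using zero c by simp
  \<comment> \<open>Off the critical line \<open>s\<close> must be real, where the moment is
    nonzero.\<close>
  from legendre_integral_zero_critical[OF \<eta>_pos this] not_crit
  obtain x where "s = of_real x" using spectral_parameter_cases by blast
  thus False using rcos_moment_real_nonzero[OF int, of x] zero by simp
qed

theorem theorem1p3:
  fixes k :: real
  shows "\<forall>s \<in> W1_nontrivial_zeros k. Re s = - 1 / 2"
proof -
  have nonneg: "\<forall>s \<in> W1_nontrivial_zeros k. Re s = - 1 / 2" if "k \<ge> 0" for k
    using that W1_zeros_small[of k] W1_zeros_2 W1_zeros_large[of k]
    by (cases k "2 :: real" rule: linorder_cases) auto
  \<comment> \<open>\<open>W1\<close> and the trivial zeros depend only on the absolute value of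
    \<open>k\<close>.\<close>
  have "W1_nontrivial_zeros \<bar>k\<bar> = W1_nontrivial_zeros k"
    by (simp add: W1_nontrivial_zeros_def W1_zeros_def W1_trivial_zeros_def abs_if W1_minus)
  thus ?thesis using nonneg[of "\<bar>k\<bar>"] by simp
qed

end
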